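(* Let $A$ be a finite subset of $\mathbb{C}^d$ and let $f : A \times A \to \mathbb{C}^d$ be any function such that for all $a_1 \neq a_2 \in A$ we have $$f(a_1,a_2) = \alpha a_1 + (1-\alpha) a_2$$ for some $\alpha = \alpha(a_1,a_2)$, where $\alpha : A \times A \to \mathbb{C} \setminus \{0,1\}$ (i.e., $f(a_1,a_2)$ is on the line passing through $a_1,a_2$ minus the two points $a_1,a_2$). Suppose that $|A +_f A| \leq K|A|$. Then $\dim(A) \leq O(K^2)$.
   Context: $A +_f A = \{ f(a,b) : a \in A,\ b \in A\}$. $|\cdot|$ denotes the cardinality of a finite set. $\dim(A)$ denotes the dimension of the (complex) linear span of $A$. The $O(\cdot)$ hides an absolute constant.
   Formalization: The formal theorem assumes K ≥ 1; without a lower bound on K the claim fails, e.g. for n points on a line missing the origin with f constantly equal to another point of that line (K = 1/n, dim(A) = 2). *)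

theory Defs
  imports Complex_Main "HOL-Library.FuncSet" "HOL-Library.Function_Algebras"
begin

text \<open>
  The constant hidden in \<open>O(K\<^sup>2)\<close> must not depend on the dimension \<open>d\<close>, so \<open>d\<close> has to be
  quantified inside the formula and cannot be a type. Therefore all the spaces \<open>\<complex>\<^sup>d\<close> are
  realised inside the complex vector space of sequences \<open>nat \<Rightarrow> complex\<close> (pointwise addition
  from \<^theory>\<open>HOL-Library.Function_Algebras\<close>), as the sequences vanishing outside
  the first \<open>d\<close> coordinates.
\<close>

type_synonym cvec = "nat \<Rightarrow> complex"

definition cscale :: "complex \<Rightarrow> cvec \<Rightarrow> cvec"  (infixr \<open>*\<^sub>c\<close> 75)
  where "c *\<^sub>c v = (\<lambda>i. c * v i)"

global_interpretation cvec: vector_space cscale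
  by unfold_locales (auto simp: cscale_def fun_eq_iff algebra_simps)

definition cspace :: "nat \<Rightarrow> cvec set"
  where "cspace d = {v. \<forall>i\<ge>d. v i = 0}"

text \<open>
  The set \<open>A +\<^sub>f A\<close>. Only the values of \<open>f\<close> on \<open>A \<times> A\<close>, including its diagonal, matter.
\<close>

definition fsumset :: "(cvec \<times> cvec \<Rightarrow> cvec) \<Rightarrow> cvec set \<Rightarrow> cvec set"
  where "fsumset f A = {f (a, b) | a b. a \<in> A \<and> b \<in> A}"

text \<open>
  The library constant \<open>cvec.dim A\<close> is the cardinality of a basis of the complex linear span
  of \<open>A\<close>; \<open>A\<close> need not be a subspace.
\<close>

end

theory Submission
  imports Defs "HOL-Analysis.Analysis"
begin

text \<open>
  Let \<open>n = |A|\<close>, \<open>D = dim A\<close>, and let \<open>H\<close> be a maximal subset of \<open>A\<close> whose dimension is at most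
  \<open>|H| D / (2 n)\<close>, so that \<open>dim H \<le> D / 2\<close>. If the span of \<open>H\<close> contains half of the points of
  \<open>A\<close>, then each of the remaining \<open>D - dim H\<close> dimensions contributes at least \<open>n / 2\<close> new points
  \<open>f (a, g)\<close> with \<open>g\<close> in the span of \<open>H\<close>, whence \<open>D \<le> 4 K\<close>.

  Otherwise consider the set \<open>A1\<close> of the points outside the span of \<open>H\<close>, modulo this span. By
  maximality no subspace contains too many of them, and therefore, after a linear change of
  coordinates, the sum of \<open>cos\<^sup>2\<close> of the angles between any fixed vector and the points of \<open>A1\<close>
  is \<open>O(n / D)\<close>. On the other hand three collinear points cannot be nearly pairwise
  orthogonal, so that the lines through pairs of points of \<open>A1\<close> force the sum of \<open>cos\<^sup>2\<close> over
  all pairs in \<open>A1 \<times> (A1 \<union> (A +\<^sub>f A))\<close> to be at least of order \<open>n\<^sup>2\<close>. Since there are at most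
  \<open>(K + 1) n\<close> points in \<open>A1 \<union> (A +\<^sub>f A)\<close>, this gives \<open>D = O(K)\<close>, which is even better than
  \<open>O(K\<^sup>2)\<close>.

  The change of coordinates is orthonormalisation with respect to a weighted \<open>\<ell>\<^sub>2\<close> norm on \<open>A1\<close>. The
  weights are powers of two such that all leverage scores are comparable. If a weight
  were huge, there would be a large gap between consecutive weights, and the points above the gap
  would span a subspace containing too many points.
\<close>

section \<open>Angles between linearly dependent vectors\<close>

definition cinner :: "'j set \<Rightarrow> ('j \<Rightarrow> complex) \<Rightarrow> ('j \<Rightarrow> complex) \<Rightarrow> complex"
  where "cinner J x y = (\<Sum>j\<in>J. x j * cnj (y j))"

definition cnorm2 :: "'j set \<Rightarrow> ('j \<Rightarrow> complex) \<Rightarrow> real"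
  where "cnorm2 J x = (\<Sum>j\<in>J. (cmod (x j))\<^sup>2)"

text \<open>Squared cosine of the angle between two vectors, with value \<open>0\<close> if one of them vanishes.\<close>

definition cos2 :: "'j set \<Rightarrow> ('j \<Rightarrow> complex) \<Rightarrow> ('j \<Rightarrow> complex) \<Rightarrow> real"
  where "cos2 J x y = (cmod (cinner J x y))\<^sup>2 / (cnorm2 J x * cnorm2 J y)"

lemma cnorm2_nonneg: "cnorm2 J x \<ge> 0"
  by (simp add: cnorm2_def sum_nonneg)

lemma cinner_self: "cinner J x x = of_real (cnorm2 J x)"
  by (simp add: cinner_def cnorm2_def complex_norm_square flip: of_real_power)

lemma cnj_cinner: "cnj (cinner J x y) = cinner J y x"
  by (simp add: cinner_def mult.commute)

lemma cinner_lin_left: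
  "cinner J (\<lambda>j. a * x j + b * y j) z = a * cinner J x z + b * cinner J y z"
  by (simp add: cinner_def sum.distrib sum_distrib_left algebra_simps)

lemma cos2_nonneg: "cos2 J x y \<ge> 0"
  by (simp add: cos2_def cnorm2_nonneg)

lemma cos2_commute: "cos2 J x y = cos2 J y x"
proof -
  have "cmod (cinner J x y) = cmod (cinner J y x)"
    by (metis cnj_cinner complex_mod_cnj)
  then show ?thesis by (simp add: cos2_def mult.commute)
qed

lemma cmod_sum_mult_le:
  "(cmod (\<Sum>j\<in>J. x j * y j))\<^sup>2 \<le> cnorm2 J x * cnorm2 J y"
proof -
  have "(cmod (\<Sum>j\<in>J. x j * y j))\<^sup>2 \<le> (\<Sum>j\<in>J. cmod (x j) * cmod (y j))\<^sup>2"
    by (intro power_mono order.trans[OF norm_sum]) (simp_all add: norm_mult)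
  also have "\<dots> \<le> cnorm2 J x * cnorm2 J y"
    unfolding cnorm2_def by (rule Cauchy_Schwarz_ineq_sum)
  finally show ?thesis .
qed

text \<open>If a norm vanishes, Cauchy-Schwarz makes the inner product vanish too, in agreement with
  the default value \<open>0\<close> of \<open>cos2\<close>. So zero vectors need no separate
  treatment when cosines are used.\<close>

lemma cmod_cinner_eq: "cmod (cinner J x y) = sqrt (cos2 J x y) * sqrt (cnorm2 J x) * sqrt (cnorm2 J y)"
proof (cases "cnorm2 J x = 0 \<or> cnorm2 J y = 0")
  case True
  have "(cmod (cinner J x y))\<^sup>2 \<le> cnorm2 J x * cnorm2 J (\<lambda>j. cnj (y j))"
    unfolding cinner_def by (rule cmod_sum_mult_le)
  also have "\<dots> = 0" using True by (auto simp: cnorm2_def)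
  finally show ?thesis using True by auto
next
  case False
  then have "(cmod (cinner J x y))\<^sup>2 = cos2 J x y * cnorm2 J x * cnorm2 J y"
    by (simp add: cos2_def)
  then have "sqrt ((cmod (cinner J x y))\<^sup>2) = sqrt (cos2 J x y) * sqrt (cnorm2 J x) * sqrt (cnorm2 J y)"
    by (simp add: real_sqrt_mult)
  then show ?thesis by simp
qed

text \<open>Taking the inner product of the relation with \<open>z\<close>, whose term is the
  longest, gives \<open>1 \<le> r + s\<close> for the cosines \<open>r\<close> and \<open>s\<close>;
  then \<open>(r + s)^2 \<le> 2 (r^2 + s^2)\<close>.\<close>

lemma cos2_dominant:
  assumes rel: "\<And>j. j \<in> J \<Longrightarrow> a * x j + b * y j + c * z j = 0"
    and x: "cmod a * sqrt (cnorm2 J x) \<le> cmod c * sqrt (cnorm2 J z)"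
    and y: "cmod b * sqrt (cnorm2 J y) \<le> cmod c * sqrt (cnorm2 J z)"
    and pos: "0 < cmod c * sqrt (cnorm2 J z)"
  shows "1/2 \<le> cos2 J x z + cos2 J y z"
proof -
  define N where "N v = sqrt (cnorm2 J v)" for v
  define r where "r = sqrt (cos2 J x z)"
  define s where "s = sqrt (cos2 J y z)"
  have r0: "r \<ge> 0" "s \<ge> 0" by (simp_all add: r_def s_def cos2_nonneg)
  have Nz: "N z > 0"
    using pos unfolding N_def by (metis mult_zero_right cnorm2_nonneg less_le real_sqrt_ge_zero)
  have "cinner J (\<lambda>j. c * z j + 0 * z j) z = cinner J (\<lambda>j. (-a) * x j + (-b) * y j) z"
    unfolding cinner_def
  proof (rule sum.cong[OF refl])
    fix j assume "j \<in> J"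
    then have "c * z j = (-a) * x j + (-b) * y j"
      using rel[of j] by (simp add: add_eq_0_iff algebra_simps)
    then show "(c * z j + 0 * z j) * cnj (z j) = ((-a) * x j + (-b) * y j) * cnj (z j)"
      by simp
  qed
  then have "c * cinner J z z = (-a) * cinner J x z + (-b) * cinner J y z"
    unfolding cinner_lin_left by simp
  then have "cmod c * (N z * N z) = cmod ((-a) * cinner J x z + (-b) * cinner J y z)"
    by (metis N_def cinner_self cnorm2_nonneg norm_mult norm_of_real abs_of_nonneg real_sqrt_mult_self)
  also have "\<dots> \<le> cmod a * cmod (cinner J x z) + cmod b * cmod (cinner J y z)"
    by (metis norm_triangle_ineq norm_mult norm_minus_cancel)
  also have "\<dots> = (cmod a * N x) * (r * N z) + (cmod b * N y) * (s * N z)"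
    by (simp add: cmod_cinner_eq N_def r_def s_def)
  also have "\<dots> \<le> (cmod c * N z) * (r * N z) + (cmod c * N z) * (s * N z)"
    using x y r0 Nz unfolding N_def[symmetric] by (intro add_mono mult_right_mono) auto
  also have "\<dots> = (cmod c * (N z * N z)) * (r + s)" by (simp add: algebra_simps)
  finally have "1 \<le> r + s"
    using pos Nz unfolding N_def[symmetric] by (simp add: zero_less_mult_iff)
  then have "1 \<le> (r + s)\<^sup>2" by simp
  moreover have "0 \<le> (r - s)\<^sup>2" by simp
  ultimately have "1/2 \<le> r\<^sup>2 + s\<^sup>2" by (simp add: power2_eq_square algebra_simps)
  then show ?thesis by (simp add: r_def s_def cos2_nonneg)
qed

text \<open>
  Among \<open>a x\<close>, \<open>b y\<close>, \<open>c z\<close> the longest one is a combination of the others with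
  bounded coefficients, so it makes a small angle with one of them.
\<close>

lemma cos2_collinear:
  assumes rel: "\<And>j. j \<in> J \<Longrightarrow> a * x j + b * y j + c * z j = 0"
    and "a \<noteq> 0" "cnorm2 J x \<noteq> 0"
  shows "1/2 \<le> cos2 J x y + cos2 J x z + cos2 J y z"
proof -
  define p where "p = cmod a * sqrt (cnorm2 J x)"
  define q where "q = cmod b * sqrt (cnorm2 J y)"
  define r where "r = cmod c * sqrt (cnorm2 J z)"
  have p: "p > 0"
    using assms cnorm2_nonneg[of J x] by (auto simp: p_def)
  have rel2: "b * y j + c * z j + a * x j = 0" "c * z j + a * x j + b * y j = 0" if "j \<in> J" for j
    using rel[OF that] by (simp_all add: algebra_simps)
  consider "q \<le> p" "r \<le> p" | "p \<le> q" "r \<le> q" | "p \<le> r" "q \<le> r" by linarith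
  then show ?thesis
  proof cases
    case 1
    then have "1/2 \<le> cos2 J y x + cos2 J z x"
      using p by (intro cos2_dominant[OF rel2(1)]) (auto simp: p_def q_def r_def)
    then show ?thesis using cos2_nonneg[of J y z] by (simp add: cos2_commute)
  next
    case 2
    then have "1/2 \<le> cos2 J z y + cos2 J x y"
      using p by (intro cos2_dominant[OF rel2(2)]) (auto simp: p_def q_def r_def)
    then show ?thesis using cos2_nonneg[of J x z] by (simp add: cos2_commute)
  next
    case 3
    then have "1/2 \<le> cos2 J x z + cos2 J y z"
      using p by (intro cos2_dominant[OF rel]) (auto simp: p_def q_def r_def)
    then show ?thesis using cos2_nonneg[of J x y] by simp
  qed
qed

section \<open>Weighted orthonormal systems of functions\<close>

text \<open>A complex subspace of functions on a set of points that carries no linear structure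
  here. Later the functions are the linear functionals vanishing on a fixed set.\<close>

definition funspace :: "('a \<Rightarrow> complex) set \<Rightarrow> bool"
  where "funspace E \<longleftrightarrow> (\<lambda>_. 0) \<in> E \<and> (\<forall>f\<in>E. \<forall>g\<in>E. \<forall>c. (\<lambda>x. f x + c * g x) \<in> E)"

lemma funspace_sum:
  assumes "funspace E" "finite I" "\<And>i. i \<in> I \<Longrightarrow> T i \<in> E"
  shows "(\<lambda>x. \<Sum>i\<in>I. c i * T i x) \<in> E"
  using assms(2,3)
proof (induction I rule: finite_induct)
  case empty
  then show ?case using assms(1) by (simp add: funspace_def)
next
  case (insert i I)
  then have "(\<lambda>x. (\<Sum>i\<in>I. c i * T i x) + c i * T i x) \<in> E"
    using assms(1) by (simp add: funspace_def)
  then show ?case using insert.hyps by (simp add: add.commute)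
qed

lemma funspace_add_scale: "funspace E \<Longrightarrow> f \<in> E \<Longrightarrow> g \<in> E \<Longrightarrow> (\<lambda>x. f x + c * g x) \<in> E"
  by (simp add: funspace_def)

lemma funspace_scale: "funspace E \<Longrightarrow> f \<in> E \<Longrightarrow> (\<lambda>x. c * f x) \<in> E"
  using funspace_sum[of E "{()}" "\<lambda>_. f" "\<lambda>_. c"] by simp

definition wform :: "'a set \<Rightarrow> ('a \<Rightarrow> real) \<Rightarrow> ('a \<Rightarrow> complex) \<Rightarrow> ('a \<Rightarrow> complex) \<Rightarrow> complex"
  where "wform H w f g = (\<Sum>a\<in>H. of_real (w a) * f a * cnj (g a))"

definition wnorm2 :: "'a set \<Rightarrow> ('a \<Rightarrow> real) \<Rightarrow> ('a \<Rightarrow> complex) \<Rightarrow> real"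
  where "wnorm2 H w f = (\<Sum>a\<in>H. w a * (cmod (f a))\<^sup>2)"

lemma wform_self: "wform H w f f = of_real (wnorm2 H w f)"
  by (simp add: wform_def wnorm2_def complex_norm_square mult.assoc flip: of_real_power)

lemma cnj_wform: "cnj (wform H w f g) = wform H w g f"
  by (simp add: wform_def mult_ac)

lemma wform_add_left: "wform H w (\<lambda>x. f x + c * g x) h = wform H w f h + c * wform H w g h"
  by (simp add: wform_def sum.distrib sum_distrib_left algebra_simps)

lemma wform_sum_left:
  "wform H w (\<lambda>x. \<Sum>i\<in>I. c i * T i x) h = (\<Sum>i\<in>I. c i * wform H w (T i) h)"
  unfolding wform_def sum_distrib_left sum_distrib_right
  by (subst sum.swap) (simp add: mult_ac)

lemma wform_sum_right:
  "wform H w h (\<lambda>x. \<Sum>i\<in>I. c i * T i x) = (\<Sum>i\<in>I. cnj (c i) * wform H w h (T i))"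
  unfolding wform_def sum_distrib_left sum_distrib_right cnj_sum
  by (subst sum.swap) (simp add: mult_ac)

section \<open>Orthonormal and dual systems, Gram-Schmidt\<close>

definition orthonormal :: "'a set \<Rightarrow> ('a \<Rightarrow> real) \<Rightarrow> 'j set \<Rightarrow> ('j \<Rightarrow> 'a \<Rightarrow> complex) \<Rightarrow> bool"
  where "orthonormal H w J T \<longleftrightarrow> (\<forall>i\<in>J. \<forall>j\<in>J. wform H w (T i) (T j) = (if i = j then 1 else 0))"

text \<open>If the functions \<open>\<psi> i\<close> lie in \<open>E\<close>, the evaluations at the
  points of \<open>I\<close> are linearly independent on \<open>E\<close>. This is how a lower bound
  \<open>card I\<close> on the rank of a point set is certified.\<close>

definition dual_system :: "'a set \<Rightarrow> ('a \<Rightarrow> 'a \<Rightarrow> complex) \<Rightarrow> bool"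
  where "dual_system I \<psi> \<longleftrightarrow> (\<forall>i\<in>I. \<forall>j\<in>I. \<psi> i j = (if i = j then 1 else 0))"

text \<open>Induction on \<open>I\<close>: the functions of \<open>E\<close> vanishing at a point
  \<open>i\<close> are handled by the rest of the dual system, and one more vector arises by
  orthogonalising \<open>\<psi> i\<close> against their basis. Expansions hold on \<open>X\<close>
  only, where functions are determined by their values on \<open>I\<close>.\<close>

lemma gram_schmidt:
  assumes "finite I" and "finite H" "I \<subseteq> H" "\<And>a. a \<in> H \<Longrightarrow> w a > 0"
    and "funspace E" "\<And>i. i \<in> I \<Longrightarrow> \<psi> i \<in> E" "dual_system I \<psi>"
    and "\<And>f a. f \<in> E \<Longrightarrow> (\<And>i. i \<in> I \<Longrightarrow> f i = 0) \<Longrightarrow> a \<in> X \<Longrightarrow> f a = 0"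
  shows "\<exists>T. (\<forall>i\<in>I. T i \<in> E) \<and> orthonormal H w I T \<and>
           (\<forall>f\<in>E. \<exists>c. \<forall>a\<in>X. f a = (\<Sum>i\<in>I. c i * T i a))"
  using assms
proof (induction I arbitrary: E rule: finite_induct)
  case empty
  then have "f a = 0" if "f \<in> E" "a \<in> X" for f a using that by simp
  then show ?case by (simp add: orthonormal_def)
next
  case (insert i I)
  define E' where "E' = {f \<in> E. f i = 0}"
  have "\<exists>T. (\<forall>i\<in>I. T i \<in> E') \<and> orthonormal H w I T \<and>
           (\<forall>f\<in>E'. \<exists>c. \<forall>a\<in>X. f a = (\<Sum>i\<in>I. c i * T i a))"
  proof (rule insert.IH)
    show "funspace E'" using insert.prems(4) by (auto simp: funspace_def E'_def)
    show "\<psi> j \<in> E'" if "j \<in> I" for j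
      using that insert.prems(5)[of j] insert.prems(6) insert.hyps
      by (auto simp: E'_def dual_system_def)
    show "dual_system I \<psi>" using insert.prems(6) by (auto simp: dual_system_def)
    show "f a = 0" if "f \<in> E'" "\<And>i. i \<in> I \<Longrightarrow> f i = 0" "a \<in> X" for f a
      by (rule insert.prems(7)[OF _ _ that(3)]) (use that in \<open>auto simp: E'_def\<close>)
    show "I \<subseteq> H" using insert.prems(2) by simp
  qed (use insert.prems(1,3) in simp_all)
  then obtain T where T: "\<And>j. j \<in> I \<Longrightarrow> T j \<in> E'" and on: "orthonormal H w I T"
    and compl: "\<And>f. f \<in> E' \<Longrightarrow> \<exists>c. \<forall>a\<in>X. f a = (\<Sum>i\<in>I. c i * T i a)"
    by metis
  define d where "d j = - wform H w (\<psi> i) (T j)" for j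
  define g where "g = (\<lambda>x. \<psi> i x + 1 * (\<Sum>j\<in>I. d j * T j x))"
  have gE: "g \<in> E"
    unfolding g_def
  proof (intro funspace_add_scale funspace_sum)
    show "T j \<in> E" if "j \<in> I" for j using T[OF that] by (simp add: E'_def)
  qed (use insert.prems(4,5) insert.hyps(1) in simp_all)
  \<comment> \<open>All \<open>T j\<close> vanish at \<open>i\<close>, so orthogonalising keeps the
    value of \<open>\<psi> i\<close> there. Since \<open>i\<close> lies in \<open>H\<close> and has
    positive weight, \<open>g\<close> can be normalised.\<close>
  have "g i = 1"
    using T insert.prems(6) by (simp add: g_def E'_def dual_system_def)
  then have "0 < w i * (cmod (g i))\<^sup>2" using insert.prems(2,3) by simp
  also have "\<dots> \<le> wnorm2 H w g"
    unfolding wnorm2_def using insert.prems(1,2)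
    by (intro member_le_sum) (simp_all add: insert.prems(3) less_imp_le)
  finally have pos: "wnorm2 H w g > 0" .
  define r where "r = 1 / sqrt (wnorm2 H w g)"
  define s where "s = complex_of_real r"
  have "r * r * wnorm2 H w g = 1" using pos by (simp add: r_def)
  then have s2: "s * cnj s * of_real (wnorm2 H w g) = 1"
    unfolding s_def complex_cnj_complex_of_real of_real_mult[symmetric] by simp
  then have s0: "s \<noteq> 0" by auto
  have gT: "wform H w g (T j) = 0" if "j \<in> I" for j
  proof -
    have "wform H w g (T j) = wform H w (\<psi> i) (T j) + (\<Sum>k\<in>I. d k * wform H w (T k) (T j))"
      unfolding g_def wform_add_left wform_sum_left by simp
    also have "(\<Sum>k\<in>I. d k * wform H w (T k) (T j)) = (\<Sum>k\<in>I. if k = j then d k else 0)"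
      using on that by (intro sum.cong) (auto simp: orthonormal_def)
    finally show ?thesis using that insert.hyps(1) by (simp add: d_def)
  qed
  define T' where "T' = T(i := (\<lambda>x. s * g x))"
  have T'I: "T' j = T j" if "j \<in> I" for j using that insert.hyps(2) by (auto simp: T'_def)
  have sg: "wform H w (\<lambda>x. s * g x) h = s * wform H w g h" for h
    using wform_add_left[of H w "\<lambda>_. 0" s g h] by (simp add: wform_def)
  have sg': "wform H w h (\<lambda>x. s * g x) = cnj s * wform H w h g" for h
    by (metis cnj_wform complex_cnj_mult sg)
  have Tg: "wform H w (T j) g = 0" if "j \<in> I" for j
    by (metis cnj_wform complex_cnj_zero gT that)
  show ?case
  proof (intro exI[of _ T'] conjI ballI)
    show "T' j \<in> E" if "j \<in> insert i I" for j
      using that T[of j] funspace_scale[OF insert.prems(4) gE, of s] by (auto simp: T'_def E'_def)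
    show "orthonormal H w (insert i I) T'"
      unfolding orthonormal_def
    proof (intro ballI)
      fix j k assume "j \<in> insert i I" "k \<in> insert i I"
      moreover have "T' i = (\<lambda>x. s * g x)" by (simp add: T'_def)
      ultimately show "wform H w (T' j) (T' k) = (if j = k then 1 else 0)"
        using on insert.hyps(2) s2
        by (auto simp: T'I sg sg' gT Tg wform_self[of _ _ g] orthonormal_def mult_ac)
    qed
    fix f assume f: "f \<in> E"
    have "(\<lambda>x. f x + (- f i) * \<psi> i x) \<in> E'"
      using funspace_add_scale[OF insert.prems(4) f insert.prems(5)[of i], of "- f i"] insert.prems(6)
      by (simp add: E'_def dual_system_def)
    then obtain c where c: "\<And>a. a \<in> X \<Longrightarrow> f a + (- f i) * \<psi> i a = (\<Sum>j\<in>I. c j * T j a)"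
      using compl by meson
    \<comment> \<open>Substitute \<open>g\<close> minus the combination of the \<open>T j\<close>
      for \<open>\<psi> i\<close>, and \<open>T' i\<close> divided by \<open>s\<close> for
      \<open>g\<close>.\<close>
    define c' where "c' j = (if j = i then f i / s else c j - f i * d j)" for j
    have "f a = (\<Sum>j\<in>insert i I. c' j * T' j a)" if "a \<in> X" for a
    proof -
      have "(\<Sum>j\<in>insert i I. c' j * T' j a) = f i * g a + (\<Sum>j\<in>I. (c j - f i * d j) * T j a)"
        using insert.hyps s0 by (simp add: c'_def T'_def cong: if_cong)
           (intro sum.cong, auto)
      also have "\<dots> = f i * \<psi> i a + (\<Sum>j\<in>I. c j * T j a)"
        by (simp add: g_def algebra_simps sum_subtractf sum_distrib_left)
      also have "\<dots> = f i * \<psi> i a + (f a + (- f i) * \<psi> i a)" by (simp only: c[OF that])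
      finally show ?thesis by simp
    qed
    then show "\<exists>c. \<forall>a\<in>X. f a = (\<Sum>j\<in>insert i I. c j * T' j a)" by blast
  qed
qed

lemma wnorm2_orthonormal_sum:
  assumes "orthonormal H w J T" "finite J"
  shows "wnorm2 H w (\<lambda>a. \<Sum>i\<in>J. c i * T i a) = cnorm2 J c"
proof -
  have "complex_of_real (wnorm2 H w (\<lambda>a. \<Sum>i\<in>J. c i * T i a)) =
      (\<Sum>i\<in>J. c i * (\<Sum>j\<in>J. cnj (c j) * wform H w (T i) (T j)))"
    unfolding wform_self[symmetric] wform_sum_left wform_sum_right ..
  also have "\<dots> = (\<Sum>i\<in>J. c i * (\<Sum>j\<in>J. if i = j then cnj (c j) else 0))"
    using assms(1) by (intro sum.cong refl arg_cong2[where f="(*)"]) (auto simp: orthonormal_def)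
  also have "\<dots> = of_real (cnorm2 J c)"
    using assms(2) by (simp add: cnorm2_def complex_norm_square flip: of_real_power)
  finally show ?thesis by (simp only: of_real_eq_iff)
qed

text \<open>The summand is the leverage score of \<open>a\<close> for the span of the system; each
  \<open>T i\<close> has norm one, so the scores add up to the rank.\<close>

lemma sum_orthonormal:
  assumes "orthonormal H w J T" "finite J"
  shows "(\<Sum>a\<in>H. w a * cnorm2 J (\<lambda>i. T i a)) = real (card J)"
proof -
  have "(\<Sum>a\<in>H. w a * cnorm2 J (\<lambda>i. T i a)) = (\<Sum>i\<in>J. wnorm2 H w (T i))"
    unfolding wnorm2_def cnorm2_def sum_distrib_left by (rule sum.swap)
  also have "\<dots> = (\<Sum>i\<in>J. 1)"
  proof (rule sum.cong[OF refl])
    fix i assume "i \<in> J"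
    then have "complex_of_real (wnorm2 H w (T i)) = 1"
      using assms(1) by (simp add: orthonormal_def flip: wform_self)
    then show "wnorm2 H w (T i) = 1" by (simp only: of_real_eq_1_iff)
  qed
  finally show ?thesis by simp
qed

section \<open>Approximate isotropic position\<close>

text \<open>
  The number \<open>w a * sup |f a|\<^sup>2 / wnorm2 A w f\<close>, the supremum taken over \<open>f \<in> E\<close>, is the
  leverage score of \<open>a\<close>; so \<open>bound\<close> says that the scores on \<open>H\<close> are at most \<open>\<tau>\<close>.
  If the weights on \<open>H\<close> dominate all others, the scores on \<open>H\<close> nearly add up to
  the rank of \<open>H\<close>.
\<close>

lemma card_le_if_few_heavy:
  assumes fin: "finite A" and "H \<subseteq> A" and E: "funspace E"
    and I: "I \<subseteq> H" "dual_system I \<psi>" "\<And>i. i \<in> I \<Longrightarrow> \<psi> i \<in> E"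
    and C: "\<And>i a. i \<in> I \<Longrightarrow> a \<in> A \<Longrightarrow> cmod (\<psi> i a) \<le> C"
    and pos: "\<And>a. a \<in> A \<Longrightarrow> w a > 0"
    and light: "\<And>a. a \<in> A - H \<Longrightarrow> w a \<le> L" and "L \<ge> 0"
    and heavy: "\<And>a. a \<in> H \<Longrightarrow> w a \<ge> L * (real (card A) * C)\<^sup>2"
    and bound: "\<And>f a. f \<in> E \<Longrightarrow> a \<in> H \<Longrightarrow> w a * (cmod (f a))\<^sup>2 \<le> \<tau> * wnorm2 A w f"
    and "\<tau> \<ge> 0"
  shows "real (card I) \<le> 2 * \<tau> * real (card H)"
proof -
  \<comment> \<open>The functions that are interpolated on \<open>A\<close> from their values on
    \<open>I\<close>; the \<open>\<psi> i\<close> are among them, so an orthonormal system of size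
    \<open>card I\<close> can be built in \<open>F\<close>.\<close>
  define F where "F = {f \<in> E. \<forall>a\<in>A. f a = (\<Sum>i\<in>I. f i * \<psi> i a)}"
  have finH: "finite H" and finI: "finite I" and IA: "I \<subseteq> A"
    using fin \<open>H \<subseteq> A\<close> I(1) by (auto intro: finite_subset)
  have "\<exists>T. (\<forall>i\<in>I. T i \<in> F) \<and> orthonormal H w I T \<and>
           (\<forall>f\<in>F. \<exists>c. \<forall>a\<in>A. f a = (\<Sum>i\<in>I. c i * T i a))"
  proof (rule gram_schmidt)
    have "(\<lambda>x. f x + c * g x) \<in> F" if "f \<in> F" "g \<in> F" for f g c
    proof -
      have "f a + c * g a = (\<Sum>i\<in>I. (f i + c * g i) * \<psi> i a)" if "a \<in> A" for a
      proof -
        have "f a + c * g a = (\<Sum>i\<in>I. f i * \<psi> i a) + c * (\<Sum>i\<in>I. g i * \<psi> i a)"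
          using \<open>f \<in> F\<close> \<open>g \<in> F\<close> that unfolding F_def by force
        then show ?thesis by (simp add: sum.distrib sum_distrib_left algebra_simps)
      qed
      then show ?thesis
        using funspace_add_scale[OF E, of f g c] that by (simp add: F_def)
    qed
    moreover have "(\<lambda>_. 0) \<in> F" using E by (simp add: F_def funspace_def)
    ultimately show "funspace F" by (simp add: funspace_def)
    show "\<psi> i \<in> F" if i: "i \<in> I" for i
    proof -
      have "(\<Sum>j\<in>I. \<psi> i j * \<psi> j a) = (\<Sum>j\<in>I. if i = j then \<psi> j a else 0)" for a
        using I(2) i by (intro sum.cong) (auto simp: dual_system_def)
      then show ?thesis using I(3) i finI by (simp add: F_def)
    qed
    show "f a = 0" if "f \<in> F" "\<And>i. i \<in> I \<Longrightarrow> f i = 0" "a \<in> A" for f a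
      using that by (simp add: F_def)
    show "w a > 0" if "a \<in> H" for a using pos that \<open>H \<subseteq> A\<close> by auto
  qed (use finI finH I in auto)
  then obtain T where T: "\<And>i. i \<in> I \<Longrightarrow> T i \<in> F" and on: "orthonormal H w I T" by metis
  \<comment> \<open>Off \<open>H\<close> the values are bounded by those on \<open>I\<close> up to
    \<open>C\<close>, and the weights on \<open>I\<close> are large enough to compensate. So the
    mass off \<open>H\<close> is at most the mass on \<open>H\<close>.\<close>
  have double: "wnorm2 A w f \<le> 2 * wnorm2 H w f"
    if f: "\<And>a. a \<in> A \<Longrightarrow> f a = (\<Sum>i\<in>I. f i * \<psi> i a)" for f
  proof -
    define S where "S = cnorm2 I f"
    have S: "(cmod (f a))\<^sup>2 \<le> S * (real (card A) * C\<^sup>2)" if "a \<in> A" for a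
    proof -
      have "(cmod (f a))\<^sup>2 \<le> S * cnorm2 I (\<lambda>i. \<psi> i a)"
        unfolding S_def f[OF that] by (rule order.trans[OF _ cmod_sum_mult_le]) simp
      also have "cnorm2 I (\<lambda>i. \<psi> i a) \<le> (\<Sum>i\<in>I. C\<^sup>2)"
        unfolding cnorm2_def using C that by (intro sum_mono power_mono) auto
      also have "\<dots> \<le> real (card A) * C\<^sup>2"
        using card_mono[OF fin IA] by (auto intro: mult_right_mono)
      finally show ?thesis by (simp add: S_def cnorm2_nonneg mult_left_mono)
    qed
    have S0: "S \<ge> 0" by (simp add: S_def cnorm2_nonneg)
    have "wnorm2 (A - H) w f \<le> (\<Sum>a\<in>A - H. L * (S * (real (card A) * C\<^sup>2)))"
      unfolding wnorm2_def using S light pos \<open>L \<ge> 0\<close>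
      by (intro sum_mono mult_mono) auto
    also have "\<dots> \<le> real (card A) * (L * (S * (real (card A) * C\<^sup>2)))"
      using card_mono[OF fin, of "A - H"] \<open>L \<ge> 0\<close> S0
      by (auto intro!: mult_right_mono)
    also have "\<dots> = (\<Sum>i\<in>I. L * (real (card A) * C)\<^sup>2 * (cmod (f i))\<^sup>2)"
      by (simp add: S_def cnorm2_def power2_eq_square sum_distrib_left algebra_simps)
    also have "\<dots> \<le> (\<Sum>i\<in>I. w i * (cmod (f i))\<^sup>2)"
      using heavy I(1) by (intro sum_mono mult_right_mono) auto
    also have "\<dots> \<le> wnorm2 H w f"
      unfolding wnorm2_def
    proof (rule sum_mono2[OF finH I(1)])
      show "0 \<le> w b * (cmod (f b))\<^sup>2" if "b \<in> H - I" for b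
        using pos[of b] that \<open>H \<subseteq> A\<close> by (simp add: subset_iff)
    qed
    finally have "wnorm2 (A - H) w f \<le> wnorm2 H w f" .
    moreover have "wnorm2 A w f = wnorm2 (A - H) w f + wnorm2 H w f"
      unfolding wnorm2_def using sum.subset_diff[OF \<open>H \<subseteq> A\<close> fin] by blast
    ultimately show ?thesis by simp
  qed
  have each: "w b * cnorm2 I (\<lambda>i. T i b) \<le> 2 * \<tau>" if b: "b \<in> H" for b
  proof -
    define s where "s = cnorm2 I (\<lambda>i. T i b)"
    \<comment> \<open>The reproducing kernel at \<open>b\<close>: its value at \<open>b\<close> and
      its squared norm on \<open>H\<close> are both \<open>s\<close>, so \<open>bound\<close> and
      \<open>double\<close> give \<open>w b * s^2 \<le> 2 * \<tau> * s\<close>.\<close>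
    define f where "f = (\<lambda>x. \<Sum>i\<in>I. cnj (T i b) * T i x)"
    have fE: "f \<in> E"
      unfolding f_def using T by (intro funspace_sum E finI) (simp add: F_def)
    have fb: "f b = of_real s"
      by (simp add: f_def s_def cnorm2_def complex_norm_square mult.commute flip: of_real_power)
    have "f a = (\<Sum>i\<in>I. f i * \<psi> i a)" if "a \<in> A" for a
    proof -
      have "f a = (\<Sum>k\<in>I. cnj (T k b) * (\<Sum>i\<in>I. T k i * \<psi> i a))"
        unfolding f_def
        using T that by (intro sum.cong refl arg_cong2[where f="(*)"]) (simp add: F_def)
      also have "\<dots> = (\<Sum>i\<in>I. f i * \<psi> i a)"
        unfolding f_def sum_distrib_left sum_distrib_right
        by (subst sum.swap) (simp add: mult_ac)
      finally show ?thesis .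
    qed
    then have "wnorm2 A w f \<le> 2 * wnorm2 H w f" by (rule double)
    also have "wnorm2 H w f = s"
      unfolding f_def wnorm2_orthonormal_sum[OF on finI] by (simp add: s_def cnorm2_def)
    finally have "\<tau> * wnorm2 A w f \<le> \<tau> * (2 * s)"
      using \<open>\<tau> \<ge> 0\<close> by (rule mult_left_mono)
    with bound[OF fE b] have "w b * s\<^sup>2 \<le> \<tau> * (2 * s)" by (simp add: fb)
    then have "w b * s * s \<le> 2 * \<tau> * s" by (simp add: power2_eq_square algebra_simps)
    moreover have "s \<ge> 0" by (simp add: s_def cnorm2_nonneg)
    ultimately show ?thesis
      using \<open>\<tau> \<ge> 0\<close> by (cases "s = 0") (auto simp: s_def[symmetric])
  qed
  have "real (card I) = (\<Sum>b\<in>H. w b * cnorm2 I (\<lambda>i. T i b))"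
    by (rule sum_orthonormal[OF on finI, symmetric])
  also have "\<dots> \<le> (\<Sum>b\<in>H. 2 * \<tau>)" by (rule sum_mono[OF each])
  finally show ?thesis by (simp add: mult.commute)
qed

text \<open>
  Doubling a weight at most doubles the score of its point and does not increase the other scores.
  Hence weights of maximal sum with all scores of points of weight \<open>> 1\<close> at most \<open>\<tau>\<close> have all
  scores at least \<open>\<tau> / 2\<close>, except where the cap \<open>2 ^ m\<close> is attained.
\<close>

lemma balanced_weights:
  fixes E :: "('a \<Rightarrow> complex) set"
  assumes fin: "finite A" and "\<tau> \<ge> 0"
  shows "\<exists>e::'a \<Rightarrow> nat. (\<forall>a\<in>A. e a \<le> m) \<and>
    (\<forall>a\<in>A. 0 < e a \<longrightarrow> (\<forall>f\<in>E. 2 ^ e a * (cmod (f a))\<^sup>2 \<le> \<tau> * wnorm2 A (\<lambda>b. 2 ^ e b) f)) \<and>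
    (\<forall>a\<in>A. e a < m \<longrightarrow> (\<exists>f\<in>E. \<tau> * wnorm2 A (\<lambda>b. 2 ^ e b) f < 2 * 2 ^ e a * (cmod (f a))\<^sup>2))"
proof -
  define P where "P e \<longleftrightarrow> (\<forall>a\<in>A. e a \<le> m) \<and>
    (\<forall>a\<in>A. 0 < e a \<longrightarrow> (\<forall>f\<in>E. 2 ^ e a * (cmod (f a))\<^sup>2 \<le> \<tau> * wnorm2 A (\<lambda>b. 2 ^ e b) f))"
    for e :: "'a \<Rightarrow> nat"
  have "P (\<lambda>_. 0)" by (simp add: P_def)
  moreover have "\<forall>e. P e \<longrightarrow> sum e A < Suc (card A * m)"
  proof (intro allI impI)
    fix e assume "P e"
    then have "sum e A \<le> (\<Sum>a\<in>A. m)" unfolding P_def by (intro sum_mono) auto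
    then show "sum e A < Suc (card A * m)" by simp
  qed
  ultimately obtain e where e: "P e" and max: "\<And>e'. P e' \<Longrightarrow> sum e' A \<le> sum e A"
    using ex_has_greatest_nat[of P "\<lambda>_. 0" "\<lambda>e. sum e A" "Suc (card A * m)"]
    by (metis (no_types, lifting) less_imp_le)
  have "\<exists>f\<in>E. \<tau> * wnorm2 A (\<lambda>b. 2 ^ e b) f < 2 * 2 ^ e a * (cmod (f a))\<^sup>2"
    if a: "a \<in> A" "e a < m" for a
  proof (rule ccontr)
    assume "\<not> ?thesis"
    then have neg: "2 * 2 ^ e a * (cmod (f a))\<^sup>2 \<le> \<tau> * wnorm2 A (\<lambda>b. 2 ^ e b) f" if "f \<in> E" for f
      using that by force
    define e' where "e' = e(a := Suc (e a))"
    have mono: "\<tau> * wnorm2 A (\<lambda>b. 2 ^ e b) f \<le> \<tau> * wnorm2 A (\<lambda>b. 2 ^ e' b) f" for f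
      unfolding wnorm2_def e'_def using \<open>\<tau> \<ge> 0\<close>
      by (intro mult_left_mono sum_mono mult_right_mono) auto
    have "P e'"
      unfolding P_def
    proof (intro conjI ballI impI)
      show "e' b \<le> m" if "b \<in> A" for b using e a that by (simp add: P_def e'_def)
      show "2 ^ e' b * (cmod (f b))\<^sup>2 \<le> \<tau> * wnorm2 A (\<lambda>b. 2 ^ e' b) f"
        if "b \<in> A" "0 < e' b" "f \<in> E" for b f
      proof (rule order.trans[OF _ mono])
        show "2 ^ e' b * (cmod (f b))\<^sup>2 \<le> \<tau> * wnorm2 A (\<lambda>b. 2 ^ e b) f"
          using neg[OF \<open>f \<in> E\<close>] e that by (cases "b = a") (auto simp: e'_def P_def)
      qed
    qed
    then have "sum e' A \<le> sum e A" by (rule max)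
    moreover have "sum e A < sum e' A"
      by (rule sum_strict_mono_ex1[OF fin]) (use a in \<open>auto simp: e'_def\<close>)
    ultimately show False by simp
  qed
  with e show ?thesis unfolding P_def by blast
qed

text \<open>Pigeonhole: the \<open>card A + 1\<close> open intervals between consecutive multiples
  of \<open>q\<close> are disjoint, so the values of \<open>e\<close> on \<open>A\<close> cannot
  meet all of them.\<close>

lemma exponent_gap:
  fixes e :: "'a \<Rightarrow> nat"
  assumes fin: "finite A"
  obtains j where "j \<le> card A" "\<And>a. a \<in> A \<Longrightarrow> e a \<le> q * j \<or> q * (j + 1) \<le> e a"
proof -
  have "\<exists>j\<le>card A. \<forall>a\<in>A. e a \<le> q * j \<or> q * (j + 1) \<le> e a"
  proof (rule ccontr)
    assume neg: "\<not> ?thesis"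
    then have "\<forall>j\<in>{..card A}. \<exists>a. a \<in> A \<and> q * j < e a \<and> e a < q * (j + 1)"
      by (meson atMost_iff not_le)
    then obtain h where h: "\<And>j. j \<in> {..card A} \<Longrightarrow> h j \<in> A \<and> q * j < e (h j) \<and> e (h j) < q * (j + 1)"
      by metis
    have "e (h j) div q = j" if "j \<in> {..card A}" for j
      using h[OF that] by (intro div_nat_eqI) (auto simp: mult.commute)
    then have "inj_on h {..card A}" by (metis inj_onI)
    moreover have "h ` {..card A} \<subseteq> A" using h by auto
    ultimately have "card {..card A} \<le> card A" using fin by (rule card_inj_on_le)
    then show False by simp
  qed
  then show ?thesis using that by blast
qed

text \<open>Take \<open>T\<close> orthonormal for balanced weights. A weight at the cap would put a
  gap below some heavy set \<open>H\<close>, contradicting \<open>spread\<close> by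
  \<open>card_le_if_few_heavy\<close>. Hence all scores exceed \<open>\<theta> / 4\<close>, and
  orthonormality bounds the sum of \<open>cos2\<close>.\<close>

lemma isotropic_position:
  assumes fin: "finite A" and E: "funspace E" and "\<theta> > 0"
    and spread: "\<And>H. H \<subseteq> A \<Longrightarrow> H \<noteq> {} \<Longrightarrow>
        \<exists>I \<psi>. I \<subseteq> H \<and> dual_system I \<psi> \<and> (\<forall>i\<in>I. \<psi> i \<in> E) \<and> \<theta> * real (card H) < real (card I)"
    and J: "J \<subseteq> A" "dual_system J \<eta>" "\<And>i. i \<in> J \<Longrightarrow> \<eta> i \<in> E"
    and full: "\<And>f a. f \<in> E \<Longrightarrow> (\<And>i. i \<in> J \<Longrightarrow> f i = 0) \<Longrightarrow> a \<in> A \<Longrightarrow> f a = 0"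
  obtains T where "\<And>i. i \<in> J \<Longrightarrow> T i \<in> E" "\<And>a. a \<in> A \<Longrightarrow> cnorm2 J (\<lambda>i. T i a) > 0"
    "\<And>u. (\<Sum>a\<in>A. cos2 J (\<lambda>i. T i a) u) \<le> 4 / \<theta>"
proof -
  obtain I \<psi> where I: "\<And>H. H \<subseteq> A \<Longrightarrow> H \<noteq> {} \<Longrightarrow>
        I H \<subseteq> H \<and> dual_system (I H) (\<psi> H) \<and> (\<forall>i\<in>I H. \<psi> H i \<in> E) \<and> \<theta> * real (card H) < real (card (I H))"
    using spread by metis
  define C where "C = (\<Sum>H\<in>Pow A. \<Sum>i\<in>A. \<Sum>a\<in>A. cmod (\<psi> H i a))"
  have C: "cmod (\<psi> H i a) \<le> C" if "H \<subseteq> A" "i \<in> A" "a \<in> A" for H i a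
  proof -
    have "cmod (\<psi> H i a) \<le> (\<Sum>a\<in>A. cmod (\<psi> H i a))"
      using that fin by (intro member_le_sum) auto
    also have "\<dots> \<le> (\<Sum>i\<in>A. \<Sum>a\<in>A. cmod (\<psi> H i a))"
      using that fin by (intro member_le_sum) (auto intro: sum_nonneg)
    also have "\<dots> \<le> C"
      unfolding C_def using that fin
      by (intro member_le_sum[where f="\<lambda>H. \<Sum>i\<in>A. \<Sum>a\<in>A. cmod (\<psi> H i a)"])
         (auto intro!: sum_nonneg)
    finally show ?thesis .
  qed
  obtain q0 where q0: "(real (card A) * C)\<^sup>2 < 2 ^ q0"
    using real_arch_pow[of 2 "(real (card A) * C)\<^sup>2"] by auto
  \<comment> \<open>The successor makes \<open>q\<close> positive, so that points above the gap have
    positive exponent and \<open>up\<close> applies to them.\<close>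
  define q where "q = Suc q0"
  have q: "(real (card A) * C)\<^sup>2 \<le> 2 ^ q"
  proof -
    have "(2::real) ^ q0 \<le> 2 ^ q" by (simp add: q_def)
    with q0 show ?thesis by linarith
  qed
  \<comment> \<open>Room for \<open>card A + 1\<close> intervals of length \<open>q\<close>: a point
    at the cap lies above whichever gap is found.\<close>
  define m where "m = q * (card A + 1)"
  \<comment> \<open>Chosen so that the bound \<open>2 * \<tau> * card H\<close> on the rank is
    exactly what \<open>spread\<close> excludes.\<close>
  define \<tau> where "\<tau> = \<theta> / 2"
  have \<tau>: "\<tau> > 0" using \<open>\<theta> > 0\<close> by (simp add: \<tau>_def)
  obtain e where em: "\<And>a. a \<in> A \<Longrightarrow> e a \<le> m"
    and up: "\<And>a f. a \<in> A \<Longrightarrow> 0 < e a \<Longrightarrow> f \<in> E \<Longrightarrow>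
        2 ^ e a * (cmod (f a))\<^sup>2 \<le> \<tau> * wnorm2 A (\<lambda>b. 2 ^ e b) f"
    and low: "\<And>a. a \<in> A \<Longrightarrow> e a < m \<Longrightarrow>
        \<exists>f\<in>E. \<tau> * wnorm2 A (\<lambda>b. 2 ^ e b) f < 2 * 2 ^ e a * (cmod (f a))\<^sup>2"
    using balanced_weights[OF fin less_imp_le[OF \<tau>], of m E] by metis
  define w where "w b = (2::real) ^ e b" for b
  have wpos: "w b > 0" for b by (simp add: w_def)
  have less: "e a < m" if "a \<in> A" for a
  proof (rule ccontr)
    assume "\<not> e a < m"
    then have ea: "e a = m" using em[OF that] by simp
    obtain j where j: "j \<le> card A" "\<And>a. a \<in> A \<Longrightarrow> e a \<le> q * j \<or> q * (j + 1) \<le> e a"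
      using exponent_gap[OF fin] by metis
    define H where "H = {b \<in> A. q * (j + 1) \<le> e b}"
    have HA: "H \<subseteq> A" by (auto simp: H_def)
    have "a \<in> H" using that ea j(1) unfolding H_def m_def by simp
    then have "H \<noteq> {}" by auto
    note IH = I[OF HA this]
    have "real (card (I H)) \<le> 2 * \<tau> * real (card H)"
    proof (rule card_le_if_few_heavy[where E=E and w=w and C=C and L="2 ^ (q * j)" and \<psi>="\<psi> H" and A=A])
      show "w b \<le> 2 ^ (q * j)" if "b \<in> A - H" for b
        unfolding w_def using that j(2)[of b] by (intro power_increasing) (auto simp: H_def)
      show "2 ^ (q * j) * (real (card A) * C)\<^sup>2 \<le> w b" if "b \<in> H" for b
      proof -
        have "2 ^ (q * j) * (real (card A) * C)\<^sup>2 \<le> 2 ^ (q * j) * 2 ^ q"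
          using q by (intro mult_left_mono) auto
        also have "\<dots> = 2 ^ (q * (j + 1))" by (simp add: power_add)
        also have "\<dots> \<le> w b"
          unfolding w_def using that by (intro power_increasing) (auto simp: H_def)
        finally show ?thesis .
      qed
      show "w b * (cmod (f b))\<^sup>2 \<le> \<tau> * wnorm2 A w f" if "f \<in> E" "b \<in> H" for f b
      proof -
        have "0 < e b" "b \<in> A" using that(2) by (auto simp: H_def q_def)
        from up[OF this(2,1) that(1)] show ?thesis unfolding w_def .
      qed
      show "cmod (\<psi> H i b) \<le> C" if "i \<in> I H" "b \<in> A" for i b
      proof (rule C[OF HA])
        show "i \<in> A" using IH HA that(1) by auto
      qed (rule that(2))
      show "0 \<le> \<tau>" using \<tau> by simp
      show "\<psi> H i \<in> E" if "i \<in> I H" for i using IH that by simp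
    qed (use IH in \<open>simp_all add: fin HA E wpos\<close>)
    with IH show False by (simp add: \<tau>_def)
  qed
  have finJ: "finite J" using J(1) fin by (rule finite_subset)
  have "\<exists>T. (\<forall>i\<in>J. T i \<in> E) \<and> orthonormal A w J T \<and>
           (\<forall>f\<in>E. \<exists>c. \<forall>a\<in>A. f a = (\<Sum>i\<in>J. c i * T i a))"
    by (rule gram_schmidt[where \<psi>=\<eta>]) (rule wpos | fact finJ fin J E full)+
  then obtain T where T: "\<And>i. i \<in> J \<Longrightarrow> T i \<in> E" and on: "orthonormal A w J T"
    and compl: "\<And>f. f \<in> E \<Longrightarrow> \<exists>c. \<forall>a\<in>A. f a = (\<Sum>i\<in>J. c i * T i a)"
    by blast
  \<comment> \<open>By Cauchy-Schwarz every \<open>f\<close> in \<open>E\<close> has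
    \<open>|f a|^2\<close> at most \<open>wnorm2 A w f\<close> times the squared norm of the vector
    of the \<open>T i a\<close>, so the witness from \<open>low\<close> bounds that norm from
    below.\<close>
  have big: "\<tau> < 2 * w a * cnorm2 J (\<lambda>i. T i a)" if a: "a \<in> A" for a
  proof -
    obtain f where f: "f \<in> E" and lt: "\<tau> * wnorm2 A w f < 2 * w a * (cmod (f a))\<^sup>2"
      using low[OF a less[OF a]] by (auto simp: w_def[abs_def])
    obtain c where c: "\<And>a. a \<in> A \<Longrightarrow> f a = (\<Sum>i\<in>J. c i * T i a)" using compl[OF f] by blast
    have "wnorm2 A w f = wnorm2 A w (\<lambda>a. \<Sum>i\<in>J. c i * T i a)"
      by (simp add: wnorm2_def c)
    then have "\<tau> * cnorm2 J c < 2 * w a * (cmod (f a))\<^sup>2"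
      using lt wnorm2_orthonormal_sum[OF on finJ] by simp
    also have "\<dots> \<le> 2 * w a * (cnorm2 J c * cnorm2 J (\<lambda>i. T i a))"
      unfolding c[OF a] using wpos[of a] by (intro mult_left_mono cmod_sum_mult_le) auto
    finally have "\<tau> * cnorm2 J c < 2 * w a * cnorm2 J (\<lambda>i. T i a) * cnorm2 J c"
      by (simp add: mult_ac)
    then show ?thesis using cnorm2_nonneg[of J c] by (simp add: mult_less_cancel_right)
  qed
  have posT: "cnorm2 J (\<lambda>i. T i a) > 0" if "a \<in> A" for a
    using big[OF that] \<tau> wpos[of a]
    by (smt (verit) zero_less_mult_iff)
  show ?thesis
  proof (rule that[of T])
    show "T i \<in> E" if "i \<in> J" for i by (rule T[OF that])
    show "cnorm2 J (\<lambda>i. T i a) > 0" if "a \<in> A" for a by (rule posT[OF that])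
    fix u
    show "(\<Sum>a\<in>A. cos2 J (\<lambda>i. T i a) u) \<le> 4 / \<theta>"
    proof (cases "cnorm2 J u = 0")
      case True
      then show ?thesis using \<open>\<theta> > 0\<close> by (simp add: cos2_def)
    next
      case False
      then have u: "cnorm2 J u > 0" using cnorm2_nonneg[of J u] by simp
      have "(\<Sum>a\<in>A. cos2 J (\<lambda>i. T i a) u)
          \<le> (\<Sum>a\<in>A. 2 / (\<tau> * cnorm2 J u) * (w a * (cmod (cinner J (\<lambda>i. T i a) u))\<^sup>2))"
      proof (rule sum_mono)
        fix a assume a: "a \<in> A"
        have "1 / cnorm2 J (\<lambda>i. T i a) \<le> 2 * w a / \<tau>"
          using big[OF a] posT[OF a] \<tau> by (simp add: field_simps)
        then have "1 / cnorm2 J (\<lambda>i. T i a) * ((cmod (cinner J (\<lambda>i. T i a) u))\<^sup>2 / cnorm2 J u)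
            \<le> 2 * w a / \<tau> * ((cmod (cinner J (\<lambda>i. T i a) u))\<^sup>2 / cnorm2 J u)"
          using u by (intro mult_right_mono) auto
        then show "cos2 J (\<lambda>i. T i a) u
            \<le> 2 / (\<tau> * cnorm2 J u) * (w a * (cmod (cinner J (\<lambda>i. T i a) u))\<^sup>2)"
          by (simp add: cos2_def mult_ac)
      qed
      \<comment> \<open>Pairing with \<open>u\<close> is evaluation of one function in the span of
        the \<open>T i\<close>, whose weighted norm is that of \<open>u\<close> by
        orthonormality.\<close>
      also have "\<dots> = 2 / (\<tau> * cnorm2 J u) * wnorm2 A w (\<lambda>a. \<Sum>i\<in>J. cnj (u i) * T i a)"
        unfolding sum_distrib_left[symmetric] by (simp add: wnorm2_def cinner_def mult.commute)
      also have "wnorm2 A w (\<lambda>a. \<Sum>i\<in>J. cnj (u i) * T i a) = cnorm2 J u"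
        unfolding wnorm2_orthonormal_sum[OF on finJ] by (simp add: cnorm2_def)
      finally show ?thesis using u \<tau> by (simp add: \<tau>_def)
    qed
  qed
qed

section \<open>Pairs of points on lines\<close>

definition cline :: "cvec \<Rightarrow> cvec \<Rightarrow> cvec set"
  where "cline a b = range (\<lambda>t. t *\<^sub>c a + (1 - t) *\<^sub>c b)"

lemma in_cline: "t *\<^sub>c a + (1 - t) *\<^sub>c b \<in> cline a b"
  by (auto simp: cline_def)

lemma ends_in_cline: "a \<in> cline a b" "b \<in> cline a b"
  using in_cline[of 1 a b] in_cline[of 0 a b] by simp_all

lemma cline_eq:
  assumes "c \<in> cline a b" "d \<in> cline a b" "c \<noteq> d"
  shows "cline c d = cline a b"
proof -
  obtain s t where c: "c = s *\<^sub>c a + (1 - s) *\<^sub>c b" and d: "d = t *\<^sub>c a + (1 - t) *\<^sub>c b"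
    using assms by (auto simp: cline_def)
  have st: "s - t \<noteq> 0" using assms(3) c d by auto
  have comb: "r *\<^sub>c c + (1 - r) *\<^sub>c d = (r * (s - t) + t) *\<^sub>c a + (1 - (r * (s - t) + t)) *\<^sub>c b" for r
    by (rule ext) (simp add: c d cscale_def algebra_simps)
  show ?thesis
  proof
    show "cline c d \<subseteq> cline a b"
      by (auto simp: cline_def[of c d] comb in_cline)
    show "cline a b \<subseteq> cline c d"
    proof
      fix x assume "x \<in> cline a b"
      then obtain u where u: "x = u *\<^sub>c a + (1 - u) *\<^sub>c b" by (auto simp: cline_def)
      \<comment> \<open>The parameter on the line through \<open>c\<close> and \<open>d\<close>,
        found by solving \<open>comb\<close> for \<open>r\<close>.\<close>
      have "(u - t) / (s - t) * (s - t) + t = u" using st by simp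
      then have "x = ((u - t) / (s - t)) *\<^sub>c c + (1 - (u - t) / (s - t)) *\<^sub>c d"
        unfolding u comb by simp
      then show "x \<in> cline c d" using in_cline by metis
    qed
  qed
qed

lemma cscale_comb_eq_left:
  assumes "t *\<^sub>c a + (1 - t) *\<^sub>c b = t *\<^sub>c a + (1 - t) *\<^sub>c c" "t \<noteq> 1"
  shows "b = c"
proof -
  have "(1 - t) *\<^sub>c b = (1 - t) *\<^sub>c c" using assms(1) by simp
  then show ?thesis using assms(2) by (simp del: cvec.scale_left_diff_distrib)
qed

lemma cscale_comb_neq:
  assumes "a \<noteq> b" "t \<noteq> 0" "t \<noteq> 1"
  shows "t *\<^sub>c a + (1 - t) *\<^sub>c b \<noteq> a" "t *\<^sub>c a + (1 - t) *\<^sub>c b \<noteq> b"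
proof -
  have "t *\<^sub>c a + (1 - t) *\<^sub>c a = a" "t *\<^sub>c b + (1 - t) *\<^sub>c b = b"
    by (auto simp: cscale_def algebra_simps fun_eq_iff)
  then show "t *\<^sub>c a + (1 - t) *\<^sub>c b \<noteq> a" "t *\<^sub>c a + (1 - t) *\<^sub>c b \<noteq> b"
    using assms cscale_comb_eq_left[of t a b a]
    by (metis, metis add_right_cancel cvec.scale_left_imp_eq)
qed

text \<open>
  On a line with \<open>r \<ge> 3\<close> points of \<open>A\<close> the inequality \<open>tri\<close> is averaged over all triples of
  points of \<open>A\<close> on the line; every pair lies in \<open>r - 2\<close> of them.
\<close>

lemma sum_pairs_on_long_lines:
  fixes g :: "cvec \<Rightarrow> cvec \<Rightarrow> real"
  assumes fin: "finite A" and sym: "\<And>a b. g a b = g b a"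
    and tri: "\<And>a b t. a \<in> A \<Longrightarrow> b \<in> A \<Longrightarrow> a \<noteq> b \<Longrightarrow> t \<noteq> 0 \<Longrightarrow>
        1/2 \<le> g a b + g a (t *\<^sub>c a + (1 - t) *\<^sub>c b) + g b (t *\<^sub>c a + (1 - t) *\<^sub>c b)"
  defines "P \<equiv> {p \<in> (SIGMA a:A. A - {a}). 3 \<le> card (A \<inter> cline (fst p) (snd p))}"
  shows "real (card P) / 6 \<le> (\<Sum>p\<in>P. g (fst p) (snd p))"
proof -
  define N where "N a b = card (A \<inter> cline a b)" for a b
  define Q where "Q = (SIGMA p:P. A \<inter> cline (fst p) (snd p) - {fst p, snd p})"
  \<comment> \<open>With \<open>r\<close> points of \<open>A\<close> on the line, a pair extends to
    \<open>r - 2\<close> triples in \<open>Q\<close>, whose weights therefore add up to one.\<close>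
  define wt where "wt x = 1 / (real (N (fst (fst x)) (snd (fst x))) - 2)" for x :: "(cvec \<times> cvec) \<times> cvec"
  \<comment> \<open>Cyclic rotation of a triple keeps its line, hence \<open>Q\<close> and
    \<open>wt\<close>. So the three terms of \<open>tri\<close> have equal weighted sums.\<close>
  define rot where "rot x = ((snd (fst x), snd x), fst (fst x))" for x :: "(cvec \<times> cvec) \<times> cvec"
  have finP: "finite P" unfolding P_def using fin by simp
  then have finQ: "finite Q" unfolding Q_def using fin by simp
  have Q_iff: "((a, b), c) \<in> Q \<longleftrightarrow> a \<in> A \<and> b \<in> A \<and> c \<in> A \<and> a \<noteq> b \<and> c \<noteq> a \<and> c \<noteq> b \<and>
      c \<in> cline a b \<and> 3 \<le> N a b" for a b c
    by (auto simp: Q_def P_def N_def)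
  have rot_line: "cline b c = cline a b" if "((a, b), c) \<in> Q" for a b c
    using that by (intro cline_eq) (auto simp: Q_iff ends_in_cline)
  have rotQ: "rot x \<in> Q" if "x \<in> Q" for x
  proof -
    obtain a b c where x: "x = ((a, b), c)" by (metis prod.exhaust_sel)
    have l: "cline b c = cline a b" using rot_line that x by blast
    then have "N b c = N a b" by (simp add: N_def)
    then show ?thesis
      using that ends_in_cline(1)[of a b] unfolding x rot_def by (auto simp: Q_iff l)
  qed
  have rot3: "rot (rot (rot x)) = x" for x by (simp add: rot_def)
  have bij: "bij_betw rot Q Q"
    by (rule bij_betwI[where g="\<lambda>x. rot (rot x)"]) (use rotQ rot3 in auto)
  have wt_rot: "wt (rot x) = wt x" if "x \<in> Q" for x
  proof -
    obtain a b c where x: "x = ((a, b), c)" by (metis prod.exhaust_sel)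
    show ?thesis using rot_line[of a b c] that unfolding x by (simp add: wt_def rot_def N_def)
  qed
  have turn: "(\<Sum>x\<in>Q. wt x * F (rot x)) = (\<Sum>x\<in>Q. wt x * F x)" for F :: "(cvec \<times> cvec) \<times> cvec \<Rightarrow> real"
  proof -
    have "(\<Sum>x\<in>Q. wt x * F x) = (\<Sum>x\<in>Q. wt (rot x) * F (rot x))"
      by (rule sum.reindex_bij_betw[OF bij, symmetric])
    then show ?thesis using wt_rot by simp
  qed
  have inner: "(\<Sum>x\<in>Q. wt x * F (fst x)) = (\<Sum>p\<in>P. F p)" for F :: "cvec \<times> cvec \<Rightarrow> real"
  proof -
    have "(\<Sum>x\<in>Q. wt x * F (fst x)) =
        (\<Sum>p\<in>P. \<Sum>c\<in>A \<inter> cline (fst p) (snd p) - {fst p, snd p}. F p / (real (N (fst p) (snd p)) - 2))"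
      unfolding Q_def using finP fin
      by (subst sum.Sigma) (auto simp: wt_def intro!: sum.cong)
    also have "\<dots> = (\<Sum>p\<in>P. F p)"
    proof (rule sum.cong[OF refl])
      fix p assume p: "p \<in> P"
      have "fst p \<noteq> snd p" using p by (auto simp: P_def)
      then have "card {fst p, snd p} = 2" by simp
      then have "card (A \<inter> cline (fst p) (snd p) - {fst p, snd p}) = N (fst p) (snd p) - 2"
        unfolding N_def using p by (subst card_Diff_subset) (auto simp: P_def ends_in_cline)
      moreover have "3 \<le> N (fst p) (snd p)" using p by (simp add: P_def N_def)
      ultimately show "(\<Sum>c\<in>A \<inter> cline (fst p) (snd p) - {fst p, snd p}. F p / (real (N (fst p) (snd p)) - 2)) = F p"
        by (simp add: of_nat_diff)
    qed
    finally show ?thesis .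
  qed
  define G where "G x = g (fst (fst x)) (snd (fst x))" for x :: "(cvec \<times> cvec) \<times> cvec"
  have "real (card P) / 2 = (\<Sum>x\<in>Q. wt x * (1/2))"
    using inner[of "\<lambda>_. 1/2"] by simp
  also have "\<dots> \<le> (\<Sum>x\<in>Q. wt x * (G x + G (rot x) + G (rot (rot x))))"
  proof (intro sum_mono mult_left_mono)
    fix x assume x: "x \<in> Q"
    obtain a b c where abc: "x = ((a, b), c)" by (metis prod.exhaust_sel)
    have Q: "((a, b), c) \<in> Q" using x abc by simp
    then obtain t where t: "c = t *\<^sub>c a + (1 - t) *\<^sub>c b" by (auto simp: Q_iff cline_def)
    have "t \<noteq> 0" using t Q by (auto simp: Q_iff)
    then have "1/2 \<le> g a b + g a c + g b c"
      unfolding t using Q by (intro tri) (auto simp: Q_iff)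
    then show "1/2 \<le> G x + G (rot x) + G (rot (rot x))"
      using sym[of a c] by (simp add: G_def rot_def abc)
    show "0 \<le> wt x" using Q by (simp add: wt_def abc Q_iff)
  qed
  also have "\<dots> = 3 * (\<Sum>x\<in>Q. wt x * G x)"
    using turn[of G] turn[of "\<lambda>x. G (rot x)"] by (simp add: distrib_left sum.distrib)
  also have "(\<Sum>x\<in>Q. wt x * G x) = (\<Sum>p\<in>P. g (fst p) (snd p))"
    unfolding G_def using inner[of "\<lambda>p. g (fst p) (snd p)"] by simp
  finally show ?thesis by simp
qed

text \<open>
  Here \<open>f (a, b)\<close> serves as third point. Since the line contains no other point of \<open>A\<close>, the pair
  \<open>a\<close>, \<open>f (a, b)\<close> determines \<open>b\<close>.
\<close>

lemma sum_pairs_on_short_lines: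
  fixes g :: "cvec \<Rightarrow> cvec \<Rightarrow> real"
  assumes fin: "finite A" "finite B" and nonneg: "\<And>a b. g a b \<ge> 0"
    and tri: "\<And>a b t. a \<in> A \<Longrightarrow> b \<in> A \<Longrightarrow> a \<noteq> b \<Longrightarrow> t \<noteq> 0 \<Longrightarrow>
        1/2 \<le> g a b + g a (t *\<^sub>c a + (1 - t) *\<^sub>c b) + g b (t *\<^sub>c a + (1 - t) *\<^sub>c b)"
    and f: "\<And>a b. a \<in> A \<Longrightarrow> b \<in> A \<Longrightarrow> a \<noteq> b \<Longrightarrow> f (a, b) = \<alpha> (a, b) *\<^sub>c a + (1 - \<alpha> (a, b)) *\<^sub>c b"
    and \<alpha>: "\<And>a b. a \<in> A \<Longrightarrow> b \<in> A \<Longrightarrow> \<alpha> (a, b) \<noteq> 0 \<and> \<alpha> (a, b) \<noteq> 1"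
    and B: "\<And>a b. a \<in> A \<Longrightarrow> b \<in> A \<Longrightarrow> f (a, b) \<in> B"
  defines "P \<equiv> {p \<in> (SIGMA a:A. A - {a}). \<not> 3 \<le> card (A \<inter> cline (fst p) (snd p))}"
  shows "real (card P) / 2 \<le> (\<Sum>p\<in>P. g (fst p) (snd p)) + 2 * (\<Sum>b\<in>B. \<Sum>a\<in>A. g a b)"
proof -
  have P: "a \<in> A" "b \<in> A" "a \<noteq> b" "f (a, b) \<in> cline a b" "f (a, b) \<noteq> a" "f (a, b) \<noteq> b"
    if "(a, b) \<in> P" for a b
    using that f[of a b] \<alpha>[of a b] in_cline cscale_comb_neq[of a b "\<alpha> (a, b)"] by (auto simp: P_def)
  have only: "c = a \<or> c = b" if "(a, b) \<in> P" "c \<in> A" "c \<in> cline a b" for a b c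
  proof (rule ccontr)
    assume neg: "\<not> ?thesis"
    have "{a, b, c} \<subseteq> A \<inter> cline a b" using that P[OF that(1)] by (auto simp: ends_in_cline)
    moreover have "card {a, b, c} = 3" using neg P[OF that(1)] by auto
    ultimately have "3 \<le> card (A \<inter> cline a b)" using fin by (metis card_mono finite_Int)
    then show False using that(1) by (simp add: P_def)
  qed
  have line: "cline a (f (a, b)) = cline a b" "cline b (f (a, b)) = cline a b" if "(a, b) \<in> P" for a b
    using P[OF that] cline_eq[of a a b "f (a, b)"] cline_eq[of b a b "f (a, b)"]
    by (simp_all add: ends_in_cline)
  have inj1: "inj_on (\<lambda>p. (f p, fst p)) P"
  proof (rule inj_onI)
    fix p q assume pq: "p \<in> P" "q \<in> P" "(f p, fst p) = (f q, fst q)"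
    obtain a b c where abc: "p = (a, b)" "q = (a, c)"
      using pq(3) by (metis prod.collapse snd_conv)
    have "cline a b = cline a c" using line(1)[of a b] line(1)[of a c] pq abc by simp
    then have "c \<in> cline a b" by (simp add: ends_in_cline)
    then show "p = q" using only[of a b c] pq abc P[of a c] by auto
  qed
  have inj2: "inj_on (\<lambda>p. (f p, snd p)) P"
  proof (rule inj_onI)
    fix p q assume pq: "p \<in> P" "q \<in> P" "(f p, snd p) = (f q, snd q)"
    obtain a b c where abc: "p = (a, b)" "q = (c, b)"
      using pq(3) by (metis prod.collapse snd_conv)
    have "cline a b = cline c b" using line(2)[of a b] line(2)[of c b] pq abc by simp
    then have "c \<in> cline a b" by (simp add: ends_in_cline)
    then show "p = q" using only[of a b c] pq abc P[of c b] by auto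
  qed
  have mem: "fst p \<in> A" "snd p \<in> A" if "p \<in> P" for p
    using that by (auto simp: P_def)
  \<comment> \<open>Injectivity embeds the pairs into \<open>B \<times> A\<close>, and nonnegative
    terms allow summing over the whole product.\<close>
  have via: "(\<Sum>p\<in>P. g (h p) (f p)) \<le> (\<Sum>b\<in>B. \<Sum>a\<in>A. g a b)"
    if inj: "inj_on (\<lambda>p. (f p, h p)) P" and h: "\<And>p. p \<in> P \<Longrightarrow> h p \<in> A" for h
  proof -
    have "(\<Sum>p\<in>P. g (h p) (f p)) = (\<Sum>x\<in>(\<lambda>p. (f p, h p)) ` P. g (snd x) (fst x))"
      by (simp add: sum.reindex[OF inj])
    also have "\<dots> \<le> (\<Sum>x\<in>B \<times> A. g (snd x) (fst x))"
    proof (rule sum_mono2)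
      show "(\<lambda>p. (f p, h p)) ` P \<subseteq> B \<times> A" using h B by (auto simp: P_def)
    qed (use fin nonneg in auto)
    also have "\<dots> = (\<Sum>b\<in>B. \<Sum>a\<in>A. g a b)"
      by (simp add: sum.cartesian_product split_def)
    finally show ?thesis .
  qed
  have "real (card P) / 2 = (\<Sum>p\<in>P. 1/2)" by simp
  also have "\<dots> \<le> (\<Sum>p\<in>P. g (fst p) (snd p) + g (fst p) (f p) + g (snd p) (f p))"
  proof (rule sum_mono)
    fix p assume "p \<in> P"
    moreover obtain a b where "p = (a, b)" by fastforce
    ultimately show "1/2 \<le> g (fst p) (snd p) + g (fst p) (f p) + g (snd p) (f p)"
      using tri[of a b "\<alpha> (a, b)"] f[of a b] \<alpha>[of a b] P[of a b] by simp
  qed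
  also have "\<dots> = (\<Sum>p\<in>P. g (fst p) (snd p)) + (\<Sum>p\<in>P. g (fst p) (f p)) + (\<Sum>p\<in>P. g (snd p) (f p))"
    by (simp add: sum.distrib)
  finally show ?thesis
    using via[OF inj1 mem(1)] via[OF inj2 mem(2)] by simp
qed

text \<open>Ordered pairs of distinct points are split by whether their line contains a third point
  of \<open>A\<close>; \<open>1/6\<close> is the weaker of the two constants.\<close>

lemma card_pairs_le_sum:
  fixes g :: "cvec \<Rightarrow> cvec \<Rightarrow> real"
  assumes fin: "finite A" "finite B" and nonneg: "\<And>a b. g a b \<ge> 0" and sym: "\<And>a b. g a b = g b a"
    and tri: "\<And>a b t. a \<in> A \<Longrightarrow> b \<in> A \<Longrightarrow> a \<noteq> b \<Longrightarrow> t \<noteq> 0 \<Longrightarrow>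
        1/2 \<le> g a b + g a (t *\<^sub>c a + (1 - t) *\<^sub>c b) + g b (t *\<^sub>c a + (1 - t) *\<^sub>c b)"
    and f: "\<And>a b. a \<in> A \<Longrightarrow> b \<in> A \<Longrightarrow> a \<noteq> b \<Longrightarrow> f (a, b) = \<alpha> (a, b) *\<^sub>c a + (1 - \<alpha> (a, b)) *\<^sub>c b"
    and \<alpha>: "\<And>a b. a \<in> A \<Longrightarrow> b \<in> A \<Longrightarrow> \<alpha> (a, b) \<noteq> 0 \<and> \<alpha> (a, b) \<noteq> 1"
    and B: "\<And>a b. a \<in> A \<Longrightarrow> b \<in> A \<Longrightarrow> f (a, b) \<in> B"
  shows "real (card A * (card A - 1)) / 6 \<le> (\<Sum>b\<in>A. \<Sum>a\<in>A. g a b) + 2 * (\<Sum>b\<in>B. \<Sum>a\<in>A. g a b)"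
proof -
  define Off where "Off = (SIGMA a:A. A - {a})"
  define P where "P = {p \<in> Off. 3 \<le> card (A \<inter> cline (fst p) (snd p))}"
  define Q where "Q = {p \<in> Off. \<not> 3 \<le> card (A \<inter> cline (fst p) (snd p))}"
  have finOff: "finite Off" unfolding Off_def using fin by simp
  have Off: "Off = P \<union> Q" "P \<inter> Q = {}" by (auto simp: P_def Q_def)
  have fPQ: "finite P" "finite Q" using finOff by (simp_all add: P_def Q_def)
  have "card Off = card A * (card A - 1)"
    using fin by (simp add: Off_def card_SigmaI)
  then have "card A * (card A - 1) = card P + card Q"
    using card_Un_disjoint[OF fPQ Off(2)] Off(1) by simp
  then have "real (card A * (card A - 1)) / 6 = real (card P) / 6 + real (card Q) / 6"
    by (simp only: of_nat_add add_divide_distrib)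
  also have "\<dots> \<le> real (card P) / 6 + real (card Q) / 2" by simp
  also have "\<dots> \<le> (\<Sum>p\<in>P. g (fst p) (snd p)) +
      ((\<Sum>p\<in>Q. g (fst p) (snd p)) + 2 * (\<Sum>b\<in>B. \<Sum>a\<in>A. g a b))"
  proof (rule add_mono)
    show "real (card P) / 6 \<le> (\<Sum>p\<in>P. g (fst p) (snd p))"
      unfolding P_def Off_def by (rule sum_pairs_on_long_lines) (fact fin sym tri)+
    show "real (card Q) / 2 \<le> (\<Sum>p\<in>Q. g (fst p) (snd p)) + 2 * (\<Sum>b\<in>B. \<Sum>a\<in>A. g a b)"
      unfolding Q_def Off_def
      by (rule sum_pairs_on_short_lines[where f=f and \<alpha>=\<alpha>]) (fact fin nonneg tri f \<alpha> B)+
  qed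
  also have "\<dots> = (\<Sum>p\<in>Off. g (fst p) (snd p)) + 2 * (\<Sum>b\<in>B. \<Sum>a\<in>A. g a b)"
    using sum.union_disjoint[OF fPQ Off(2), of "\<lambda>p. g (fst p) (snd p)"] by (simp add: Off(1))
  also have "(\<Sum>p\<in>Off. g (fst p) (snd p)) \<le> (\<Sum>p\<in>A \<times> A. g (fst p) (snd p))"
    using fin nonneg by (intro sum_mono2) (auto simp: Off_def)
  also have "\<dots> = (\<Sum>b\<in>A. \<Sum>a\<in>A. g a b)"
    by (subst sum.swap) (simp add: sum.cartesian_product split_def)
  finally show ?thesis by simp
qed

section \<open>The dimension bound\<close>

abbreviation clinear :: "(cvec \<Rightarrow> complex) \<Rightarrow> bool"
  where "clinear \<equiv> Vector_Spaces.linear cscale (*)"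

interpretation functional: vector_space_pair cscale "(*) :: complex \<Rightarrow> complex \<Rightarrow> complex"
  by unfold_locales

text \<open>Extend a basis of the span of \<open>H\<close> by points \<open>I\<close> of
  \<open>H'\<close> and take the coordinate functionals of the new points. Functionals vanishing on
  \<open>H\<close> replace the quotient by its span, in which \<open>H'\<close> has rank
  \<open>card I\<close>.\<close>

lemma dual_system_modulo:
  assumes "finite H" "finite H'"
  obtains I \<psi> where "I \<subseteq> H'" "dual_system I \<psi>" "\<And>i. i \<in> I \<Longrightarrow> clinear (\<psi> i)"
    "\<And>i h. i \<in> I \<Longrightarrow> h \<in> H \<Longrightarrow> \<psi> i h = 0" "cvec.dim H + card I = cvec.dim (H \<union> H')"
    "H' \<subseteq> cvec.span (H \<union> I)"
proof -
  obtain B where B: "B \<subseteq> H" "cvec.independent B" "H \<subseteq> cvec.span B" "card B = cvec.dim H"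
    using cvec.basis_exists by metis
  obtain B' where B': "B \<subseteq> B'" "B' \<subseteq> B \<union> H'" "cvec.independent B'" "B \<union> H' \<subseteq> cvec.span B'"
    using cvec.maximal_independent_subset_extend[of B "B \<union> H'"] B(2) by blast
  define I where "I = B' - B"
  have fin: "finite B" "finite B'"
    using B(1) B'(2) assms by (auto intro: finite_subset)
  have "\<forall>i. \<exists>g. clinear g \<and> (\<forall>x\<in>B'. g x = (if x = i then 1 else 0))"
    by (rule allI, rule functional.linear_independent_extend[OF B'(3)])
  from choice[OF this] obtain \<psi>
    where \<psi>: "\<forall>i. clinear (\<psi> i) \<and> (\<forall>x\<in>B'. \<psi> i x = (if x = i then 1 else 0))" ..
  have HB': "H \<union> H' \<subseteq> cvec.span B'"
    using B(3) B'(4) cvec.span_mono[OF B'(1)] by simp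
  show ?thesis
  proof (rule that[of I \<psi>])
    show "I \<subseteq> H'" using B'(2) by (auto simp: I_def)
    show "dual_system I \<psi>"
      unfolding dual_system_def
    proof (intro ballI)
      fix i j assume "i \<in> I" "j \<in> I"
      then have "j \<in> B'" by (simp add: I_def)
      with \<psi> show "\<psi> i j = (if i = j then 1 else 0)" by simp
    qed
    show "clinear (\<psi> i)" for i using \<psi> by blast
    show "\<psi> i h = 0" if ih: "i \<in> I" "h \<in> H" for i h
    proof (rule functional.linear_eq_0_on_span[of "\<psi> i" B])
      show "clinear (\<psi> i)" using \<psi> by blast
      show "h \<in> cvec.span B" using B(3) ih(2) by (rule subsetD)
      fix x assume "x \<in> B"
      then have "x \<in> B'" "x \<noteq> i" using B'(1) ih(1) by (auto simp: I_def)
      then show "\<psi> i x = 0" using \<psi> by simp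
    qed
    have "cvec.span B' = cvec.span (H \<union> H')"
    proof
      have "B' \<subseteq> H \<union> H'" using B(1) B'(2) by auto
      then show "cvec.span B' \<subseteq> cvec.span (H \<union> H')" by (rule cvec.span_mono)
      show "cvec.span (H \<union> H') \<subseteq> cvec.span B'"
        by (rule cvec.span_minimal[OF HB' cvec.subspace_span])
    qed
    then have "cvec.dim (H \<union> H') = card B'" by (rule cvec.dim_eq_card[OF _ B'(3)])
    moreover have "card B + card I = card B'"
      unfolding I_def using fin B'(1) by (metis card_Diff_subset card_mono le_add_diff_inverse)
    ultimately show "cvec.dim H + card I = cvec.dim (H \<union> H')" using B(4) by simp
    have "B' \<subseteq> H \<union> I" using B(1) by (auto simp: I_def)
    then have "cvec.span B' \<subseteq> cvec.span (H \<union> I)" by (rule cvec.span_mono)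
    with HB' show "H' \<subseteq> cvec.span (H \<union> I)" by (meson Un_subset_iff subset_trans)
  qed
qed

lemma clinear_comb: "clinear \<phi> \<Longrightarrow> \<phi> (s *\<^sub>c a + t *\<^sub>c b) = s * \<phi> a + t * \<phi> b"
  by (simp add: functional.linear_add functional.linear_scale)

text \<open>
  The point \<open>f (i, g)\<close> determines \<open>i\<close>, as the only index where the dual system does not
  vanish, and then \<open>\<alpha> (i, g)\<close> and \<open>g\<close>.
\<close>

lemma card_independent_times_card_le:
  assumes fin: "finite B" and f: "\<And>a b. a \<in> A \<Longrightarrow> b \<in> A \<Longrightarrow> a \<noteq> b \<Longrightarrow> f (a, b) = \<alpha> (a, b) *\<^sub>c a + (1 - \<alpha> (a, b)) *\<^sub>c b"
    and \<alpha>: "\<And>a b. a \<in> A \<Longrightarrow> b \<in> A \<Longrightarrow> \<alpha> (a, b) \<noteq> 0 \<and> \<alpha> (a, b) \<noteq> 1"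
    and B: "\<And>a b. a \<in> A \<Longrightarrow> b \<in> A \<Longrightarrow> f (a, b) \<in> B"
    and J: "J \<subseteq> A" "dual_system J \<psi>" "\<And>i. i \<in> J \<Longrightarrow> clinear (\<psi> i)"
    and G: "G \<subseteq> A" "\<And>i g. i \<in> J \<Longrightarrow> g \<in> G \<Longrightarrow> \<psi> i g = 0"
  shows "card J * card G \<le> card B"
proof -
  have \<psi>f: "\<psi> k (f (i, g)) = \<alpha> (i, g) * \<psi> k i" if "i \<in> J" "k \<in> J" "g \<in> G" for i k g
  proof -
    \<comment> \<open>The formula for \<open>f\<close> holds off the diagonal only;
      \<open>\<psi> i\<close> is \<open>1\<close> at \<open>i\<close> and \<open>0\<close> at
      \<open>g\<close>.\<close>
    have "i \<noteq> g" using that G(2)[of i g] J(2) by (auto simp: dual_system_def)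
    then have "f (i, g) = \<alpha> (i, g) *\<^sub>c i + (1 - \<alpha> (i, g)) *\<^sub>c g"
      using f that J(1) G(1) by blast
    then show ?thesis using G(2)[OF that(2,3)] by (simp add: clinear_comb[OF J(3)[OF that(2)]])
  qed
  have "inj_on f (J \<times> G)"
  proof (rule inj_onI)
    fix x y assume "x \<in> J \<times> G" "y \<in> J \<times> G" and eq: "f x = f y"
    then obtain i g k h where x: "x = (i, g)" "i \<in> J" "g \<in> G" and y: "y = (k, h)" "k \<in> J" "h \<in> G"
      by auto
    have "\<alpha> (i, g) \<noteq> 0" using \<alpha> x J(1) G(1) by blast
    have "\<alpha> (i, g) * \<psi> i i = \<alpha> (k, h) * \<psi> i k"
      using \<psi>f[of i i g] \<psi>f[of k i h] eq x y by simp
    then have ik: "i = k" and al: "\<alpha> (i, g) = \<alpha> (k, h)"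
      using J(2) x(2) y(2) \<open>\<alpha> (i, g) \<noteq> 0\<close> by (auto simp: dual_system_def split: if_splits)
    have "i \<noteq> g" "k \<noteq> h"
      using G(2)[OF x(2,3)] G(2)[OF y(2,3)] J(2) x y by (auto simp: dual_system_def)
    then have "f (i, g) = \<alpha> (i, g) *\<^sub>c i + (1 - \<alpha> (i, g)) *\<^sub>c g"
        "f (k, h) = \<alpha> (k, h) *\<^sub>c k + (1 - \<alpha> (k, h)) *\<^sub>c h"
      using f x y J(1) G(1) by blast+
    then have "g = h"
      using eq x y ik al \<alpha>[of i g] J(1) G(1) cscale_comb_eq_left[of "\<alpha> (i, g)" i g h] by auto
    then show "x = y" using x y ik by simp
  qed
  then have "card (J \<times> G) \<le> card B"
    using fin B J(1) G(1) by (intro card_inj_on_le[of f]) auto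
  then show ?thesis by (simp add: card_cartesian_product)
qed

text \<open>Take \<open>H\<close> of maximal cardinality satisfying the dimension bound, which the
  empty set satisfies. Subtracting the two bounds shows that \<open>H'\<close> has rank above
  \<open>\<theta> * card H'\<close> modulo the span of \<open>H\<close>, as \<open>spread\<close>
  requires.\<close>

lemma heavy_subset_exists:
  assumes "finite A" "\<theta> \<ge> 0"
  obtains H where "H \<subseteq> A" "real (cvec.dim H) \<le> \<theta> * real (card H)"
    "\<And>H'. H' \<subseteq> A \<Longrightarrow> H' \<noteq> {} \<Longrightarrow> H \<inter> H' = {} \<Longrightarrow>
       real (cvec.dim (H \<union> H')) > \<theta> * (real (card H) + real (card H'))"
proof -
  define P where "P H \<longleftrightarrow> H \<subseteq> A \<and> real (cvec.dim H) \<le> \<theta> * real (card H)" for H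
  have "P {}" using cvec.dim_eq_card_independent[OF cvec.independent_empty] by (simp add: P_def)
  moreover have "\<forall>H. P H \<longrightarrow> card H < Suc (card A)"
    using assms(1) by (auto simp: P_def less_Suc_eq_le card_mono)
  ultimately obtain H where H: "P H" and max: "\<And>H'. P H' \<Longrightarrow> card H' \<le> card H"
    using ex_has_greatest_nat[of P "{}" card "Suc (card A)"] by (metis (no_types, lifting) less_imp_le)
  show ?thesis
  proof (rule that[of H])
    show "H \<subseteq> A" "real (cvec.dim H) \<le> \<theta> * real (card H)" using H by (simp_all add: P_def)
    fix H' assume H': "H' \<subseteq> A" "H' \<noteq> {}" "H \<inter> H' = {}"
    have fin: "finite H" "finite H'" using assms(1) H H'(1) by (auto simp: P_def intro: finite_subset)
    then have card: "card (H \<union> H') = card H + card H'" using H'(3) by (rule card_Un_disjoint)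
    have "card H' > 0" using H'(2) fin by (simp add: card_gt_0_iff)
    then have "\<not> P (H \<union> H')" using max[of "H \<union> H'"] card by auto
    then show "real (cvec.dim (H \<union> H')) > \<theta> * (real (card H) + real (card H'))"
      using H H'(1) card by (simp add: P_def)
  qed
qed

lemma funspace_clinear_vanishing: "funspace {\<phi>. clinear \<phi> \<and> (\<forall>h\<in>H. \<phi> h = 0)}"
proof -
  have "clinear (\<lambda>_. 0)" by (rule functional.linear_zero)
  moreover have "clinear (\<lambda>x. f x + c * g x)" if "clinear f" "clinear g" for f g c
    by (intro functional.linear_compose_add functional.linear_compose_scale_right that)
  ultimately show ?thesis by (simp add: funspace_def)
qed

section \<open>Linear bound: many or few points in the span of the heavy subset\<close>

lemma dim_le_linear:
  assumes fin: "finite A" "finite B" and f: "\<And>a b. a \<in> A \<Longrightarrow> b \<in> A \<Longrightarrow> a \<noteq> b \<Longrightarrow> f (a, b) = \<alpha> (a, b) *\<^sub>c a + (1 - \<alpha> (a, b)) *\<^sub>c b"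
    and \<alpha>: "\<And>a b. a \<in> A \<Longrightarrow> b \<in> A \<Longrightarrow> \<alpha> (a, b) \<noteq> 0 \<and> \<alpha> (a, b) \<noteq> 1"
    and B: "\<And>a b. a \<in> A \<Longrightarrow> b \<in> A \<Longrightarrow> f (a, b) \<in> B"
    and K: "1 \<le> K" "real (card B) \<le> K * real (card A)"
  shows "real (cvec.dim A) \<le> 1152 * K"
proof (cases "cvec.dim A = 0")
  case True
  then show ?thesis using K by simp
next
  case False
  define n where "n = real (card A)"
  define D where "D = real (cvec.dim A)"
  \<comment> \<open>With this density, \<open>card H \<le> n\<close> forces the dimension of
    \<open>H\<close> to be at most \<open>D / 2\<close>.\<close>
  define \<theta> where "\<theta> = D / (2 * n)"
  have D: "D > 0" using False by (simp add: D_def)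
  have Dn: "D \<le> n" using cvec.dim_le_card'[OF fin(1)] by (simp add: D_def n_def)
  with D have n: "n > 0" by simp
  have \<theta>: "\<theta> > 0" using D n by (simp add: \<theta>_def)
  obtain H where H: "H \<subseteq> A" "real (cvec.dim H) \<le> \<theta> * real (card H)"
    and max: "\<And>H'. H' \<subseteq> A \<Longrightarrow> H' \<noteq> {} \<Longrightarrow> H \<inter> H' = {} \<Longrightarrow>
       real (cvec.dim (H \<union> H')) > \<theta> * (real (card H) + real (card H'))"
    using heavy_subset_exists[OF fin(1) less_imp_le[OF \<theta>]] by metis
  define G where "G = A \<inter> cvec.span H"
  define A1 where "A1 = A - cvec.span H"
  have HG: "H \<subseteq> G" using H(1) cvec.span_superset by (auto simp: G_def)
  have finH: "finite H" using H(1) fin(1) by (rule finite_subset)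
  have finA1: "finite A1" using fin(1) by (simp add: A1_def)
  have dimH: "real (cvec.dim H) \<le> D / 2"
  proof -
    have "\<theta> * real (card H) \<le> \<theta> * n"
      using \<theta> card_mono[OF fin(1) H(1)] by (simp add: n_def)
    then show ?thesis using H(2) n by (simp add: \<theta>_def)
  qed
  \<comment> \<open>\<open>J\<close> completes \<open>H\<close> to a spanning set of the span of
    \<open>A\<close>, so it has at least \<open>D / 2\<close> elements.\<close>
  obtain J \<psi> where J: "J \<subseteq> A1" "dual_system J \<psi>" "\<And>i. i \<in> J \<Longrightarrow> clinear (\<psi> i)"
    "\<And>i h. i \<in> J \<Longrightarrow> h \<in> H \<Longrightarrow> \<psi> i h = 0"
    and dimJ: "cvec.dim H + card J = cvec.dim (H \<union> A1)" and A1J: "A1 \<subseteq> cvec.span (H \<union> J)"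
    using dual_system_modulo[OF finH finA1] by metis
  have "cvec.span (H \<union> A1) = cvec.span A"
  proof
    show "cvec.span (H \<union> A1) \<subseteq> cvec.span A"
      using H(1) by (intro cvec.span_mono) (auto simp: A1_def)
    have "A \<subseteq> cvec.span H \<union> A1" by (auto simp: A1_def)
    also have "\<dots> \<subseteq> cvec.span (H \<union> A1)"
      using cvec.span_mono[of H "H \<union> A1"] cvec.span_superset[of "H \<union> A1"] by auto
    finally show "cvec.span A \<subseteq> cvec.span (H \<union> A1)"
      by (intro cvec.span_minimal) auto
  qed
  then have "cvec.dim (H \<union> A1) = cvec.dim A" by (metis cvec.dim_span)
  then have DJ: "D \<le> D / 2 + real (card J)" using dimJ dimH by (simp add: D_def)
  have "A = G \<union> A1" "G \<inter> A1 = {}" by (auto simp: G_def A1_def)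
  then have split: "n = real (card G) + real (card A1)"
    using fin(1) finA1 by (metis card_Un_disjoint finite_Un n_def of_nat_add)
  show ?thesis
  proof (cases "n / 2 \<le> real (card G)")
    \<comment> \<open>Here \<open>card J * n / 2\<close> is at most \<open>card B\<close>, hence at
      most \<open>K * n\<close>; so \<open>card J \<le> 2 * K\<close> and
      \<open>D \<le> 4 * K\<close>.\<close>
    case True
    have "\<psi> i g = 0" if "i \<in> J" "g \<in> G" for i g
      using functional.linear_eq_0_on_span[OF J(3)[OF that(1)], of H g] J(4) that by (auto simp: G_def)
    moreover have "J \<subseteq> A" "G \<subseteq> A" using J(1) by (auto simp: A1_def G_def)
    ultimately have "card J * card G \<le> card B"
      using J(2,3) by (intro card_independent_times_card_le[OF fin(2) f \<alpha> B])
    then have "real (card J) * real (card G) \<le> K * n"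
      using K(2) unfolding n_def of_nat_mult[symmetric] by linarith
    moreover have "real (card J) * (n / 2) \<le> real (card J) * real (card G)"
      using True by (intro mult_left_mono) auto
    ultimately have "real (card J) * n \<le> 2 * K * n" by simp
    then have "real (card J) \<le> 2 * K" using n by simp
    then show ?thesis using DJ K(1) by (simp add: D_def)
  next
    case False
    define n1 where "n1 = real (card A1)"
    have n1: "n < 2 * n1" "n1 \<le> n" using False split by (simp_all add: n1_def)
    define E where "E = {\<phi>. clinear \<phi> \<and> (\<forall>h\<in>H. \<phi> h = 0)}"
    obtain T where T: "\<And>i. i \<in> J \<Longrightarrow> T i \<in> E" "\<And>a. a \<in> A1 \<Longrightarrow> cnorm2 J (\<lambda>i. T i a) > 0"
      "\<And>u. (\<Sum>a\<in>A1. cos2 J (\<lambda>i. T i a) u) \<le> 4 / \<theta>"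
    proof (rule isotropic_position[where A=A1 and E=E and \<theta>=\<theta> and J=J and \<eta>=\<psi>])
      show "funspace E" unfolding E_def by (rule funspace_clinear_vanishing)
      show "\<exists>I \<psi>. I \<subseteq> H' \<and> dual_system I \<psi> \<and> (\<forall>i\<in>I. \<psi> i \<in> E) \<and> \<theta> * real (card H') < real (card I)"
        if H': "H' \<subseteq> A1" "H' \<noteq> {}" for H'
      proof -
        obtain I \<psi> where I: "I \<subseteq> H'" "dual_system I \<psi>" "\<And>i. i \<in> I \<Longrightarrow> clinear (\<psi> i)"
          "\<And>i h. i \<in> I \<Longrightarrow> h \<in> H \<Longrightarrow> \<psi> i h = 0" "cvec.dim H + card I = cvec.dim (H \<union> H')"
          using dual_system_modulo[OF finH finite_subset[OF H'(1) finA1]] by metis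
        have "H \<inter> H' = {}" using HG H'(1) by (auto simp: A1_def G_def)
        then have "\<theta> * (real (card H) + real (card H')) < real (cvec.dim (H \<union> H'))"
          using H' by (intro max) (auto simp: A1_def)
        also have "\<dots> = real (cvec.dim H) + real (card I)" using I(5) by simp
        finally have "\<theta> * real (card H') < real (card I)" using H(2) by (simp add: distrib_left)
        then show ?thesis using I(1-4) by (intro exI[of _ I] exI[of _ \<psi>]) (simp add: E_def)
      qed
      show "\<psi> i \<in> E" if "i \<in> J" for i using J that by (simp add: E_def)
      show "\<phi> a = 0" if "\<phi> \<in> E" "\<And>i. i \<in> J \<Longrightarrow> \<phi> i = 0" "a \<in> A1" for \<phi> a
        using functional.linear_eq_0_on_span[of \<phi> "H \<union> J" a] that A1J by (auto simp: E_def)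
    qed (use finA1 \<theta> J in auto)
    define g where "g a b = cos2 J (\<lambda>i. T i a) (\<lambda>i. T i b)" for a b
    have "real (card A1 * (card A1 - 1)) / 6 \<le> (\<Sum>b\<in>A1. \<Sum>a\<in>A1. g a b) + 2 * (\<Sum>b\<in>B. \<Sum>a\<in>A1. g a b)"
    proof (rule card_pairs_le_sum[where f=f and \<alpha>=\<alpha>])
      fix a b :: cvec and t :: complex
      assume ab: "a \<in> A1" "b \<in> A1" "a \<noteq> b" "t \<noteq> 0"
      show "1/2 \<le> g a b + g a (t *\<^sub>c a + (1 - t) *\<^sub>c b) + g b (t *\<^sub>c a + (1 - t) *\<^sub>c b)"
        unfolding g_def
      \<comment> \<open>The functionals \<open>T j\<close> preserve the affine relation. Only the
        image of \<open>a\<close> has to be nonzero, so the third point may lie in the span of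
        \<open>H\<close>.\<close>
      proof (rule cos2_collinear[where a=t and b="1 - t" and c="-1"])
        show "t * T j a + (1 - t) * T j b + - 1 * T j (t *\<^sub>c a + (1 - t) *\<^sub>c b) = 0" if "j \<in> J" for j
          using T(1)[OF that] by (simp add: E_def clinear_comb del: cvec.scale_left_diff_distrib)
      qed (use ab T(2)[of a] in auto)
    qed (use finA1 fin f \<alpha> B in \<open>auto simp: g_def cos2_nonneg A1_def intro: cos2_commute\<close>)
    \<comment> \<open>The isotropy bound holds for every vector \<open>u\<close>, in particular for
      the image of any point of \<open>B\<close>.\<close>
    also have "\<dots> \<le> (\<Sum>b\<in>A1. 4 / \<theta>) + 2 * (\<Sum>b\<in>B. 4 / \<theta>)"
      unfolding g_def by (intro add_mono mult_left_mono sum_mono T(3)) auto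
    also have "\<dots> = (n1 + 2 * real (card B)) * (4 / \<theta>)" by (simp add: n1_def distrib_right add_divide_distrib)
    also have "\<dots> \<le> (K * n + 2 * (K * n)) * (4 / \<theta>)"
    proof (intro mult_right_mono add_mono)
      have "1 * n \<le> K * n" using K(1) n by (intro mult_right_mono) auto
      then show "n1 \<le> K * n" using n1(2) by linarith
      show "2 * real (card B) \<le> 2 * (K * n)" using K(2) by (simp add: n_def)
      show "0 \<le> 4 / \<theta>" using \<theta> by simp
    qed
    also have "\<dots> = 24 * K * n\<^sup>2 / D" by (simp add: \<theta>_def power2_eq_square)
    finally have main: "real (card A1 * (card A1 - 1)) / 6 \<le> 24 * K * n\<^sup>2 / D" .
    show ?thesis
    proof (cases "card A1 \<le> 1")
      \<comment> \<open>Then \<open>n < 2 * n1 \<le> 2\<close>, and \<open>D \<le> n\<close>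
        suffices.\<close>
      case True
      then have "n \<le> 2" using n1(1) by (simp add: n1_def)
      then show ?thesis using Dn K(1) by (simp add: D_def)
    next
      case False
      then have "real (card A1 - 1) = n1 - 1" "2 \<le> n1" by (simp_all add: n1_def of_nat_diff)
      \<comment> \<open>From \<open>n1 - 1 \<ge> n1 / 2\<close> and \<open>n1 \<ge> n / 2\<close>
        the left side of \<open>main\<close> is at least \<open>n^2 / 48\<close>, whence the
        constant \<open>1152 = 24 * 48\<close>.\<close>
      then have "n1 * (n1 / 2) \<le> real (card A1 * (card A1 - 1))"
        unfolding of_nat_mult by (simp add: n1_def)
      moreover have "(n / 2) * (n / 2) \<le> n1 * n1" using n1 n by (intro mult_mono) auto
      ultimately have "n\<^sup>2 / 48 \<le> real (card A1 * (card A1 - 1)) / 6"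
        by (simp add: power2_eq_square)
      with main have "n\<^sup>2 / 48 \<le> 24 * K * n\<^sup>2 / D" by (rule order.trans[rotated])
      then have "n\<^sup>2 * D \<le> n\<^sup>2 * (1152 * K)" using D by (simp add: field_simps)
      then show ?thesis using n by (simp add: D_def)
    qed
  qed
qed

theorem theorem1p16:
  "\<exists>C::real. \<forall>(d::nat) (A::cvec set) (f::cvec \<times> cvec \<Rightarrow> cvec) (\<alpha>::cvec \<times> cvec \<Rightarrow> complex) (K::real).
     finite A \<longrightarrow> A \<subseteq> cspace d \<longrightarrow>
     f \<in> A \<times> A \<rightarrow> cspace d \<longrightarrow>
     \<alpha> \<in> A \<times> A \<rightarrow> UNIV - {0, 1} \<longrightarrow>
     (\<forall>a1\<in>A. \<forall>a2\<in>A. a1 \<noteq> a2 \<longrightarrow>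
        f (a1, a2) = \<alpha> (a1, a2) *\<^sub>c a1 + (1 - \<alpha> (a1, a2)) *\<^sub>c a2) \<longrightarrow>
     1 \<le> K \<longrightarrow>
     real (card (fsumset f A)) \<le> K * real (card A) \<longrightarrow>
     real (cvec.dim A) \<le> C * K\<^sup>2"
proof (intro exI[of _ 1152] allI impI)
  fix d :: nat and A :: "cvec set" and f :: "cvec \<times> cvec \<Rightarrow> cvec"
    and \<alpha> :: "cvec \<times> cvec \<Rightarrow> complex" and K :: real
  assume A: "finite A" and \<alpha>: "\<alpha> \<in> A \<times> A \<rightarrow> UNIV - {0, 1}"
    and f: "\<forall>a1\<in>A. \<forall>a2\<in>A. a1 \<noteq> a2 \<longrightarrow>
        f (a1, a2) = \<alpha> (a1, a2) *\<^sub>c a1 + (1 - \<alpha> (a1, a2)) *\<^sub>c a2"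
    and K: "1 \<le> K" "real (card (fsumset f A)) \<le> K * real (card A)"
  have "fsumset f A = f ` (A \<times> A)" by (auto simp: fsumset_def)
  then have "finite (fsumset f A)" using A by simp
  then have "real (cvec.dim A) \<le> 1152 * K"
  proof (rule dim_le_linear[OF A])
    show "f (a, b) = \<alpha> (a, b) *\<^sub>c a + (1 - \<alpha> (a, b)) *\<^sub>c b" if "a \<in> A" "b \<in> A" "a \<noteq> b" for a b
      using f that by blast
    show "\<alpha> (a, b) \<noteq> 0 \<and> \<alpha> (a, b) \<noteq> 1" if "a \<in> A" "b \<in> A" for a b
      using \<alpha> that by (auto simp: Pi_iff)
    show "f (a, b) \<in> fsumset f A" if "a \<in> A" "b \<in> A" for a b
      using that by (auto simp: fsumset_def)
  qed (use K in auto)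
  also have "\<dots> \<le> 1152 * K\<^sup>2" using K(1) self_le_power[of K 2] by simp
  finally show "real (cvec.dim A) \<le> 1152 * K\<^sup>2" .
qed

end
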